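(* Let $n\ge 1$ be an integer. Then for all $f\in\mathcal{H}^{\mathsf{cc}}_{2n-1}$, $$\frac{1}{|\triangle|}\int_{\triangle} f(\mathbf t)\,d\mathbf t=\frac1{n^2}\sum_{\mathbf j\in\Upsilon_n}\omega^{(n)}_{\mathbf j}\,f\!\left(\frac{\mathbf j}{n}\right),$$ where for $\mathbf j\in\Upsilon_n$ the weight $\omega_{\mathbf j}^{(n)}=c^{(n)}_{\mathbf j}|\mathbf jG_2|$ equals $12$ if $0<j_2<j_1<-j_3<n$ (interior), $1$ if $\mathbf j=(0,0,0)$, $2$ if $\mathbf j=(n,0,-n)$, $3$ if $\mathbf j=(\frac n2,\frac n2,-n)$, and $6$ otherwise (remaining boundary points). Moreover, with the discrete inner product $\langle f,g\rangle_{\triangle,n}=\frac1{n^2}\sum_{\mathbf j\in\Upsilon_n}\omega^{(n)}_{\mathbf j}f(\frac{\mathbf j}{n})\overline{g(\frac{\mathbf j}{n})}$ and $\widehat{\mathbf k}=(k_3-k_2,\,k_1-k_3,\,k_2-k_1)$, one has $$\langle \mathsf{CC}_{\mathbf j},\mathsf{CC}_{\mathbf k}\rangle_{\triangle,n}=\frac{\delta_{\mathbf j,\mathbf k}}{c^{(n)}_{\widehat{\mathbf k}}|\mathbf kG_2|}=\frac{\delta_{\mathbf j,\mathbf k}}{\omega^{(n)}_{\widehat{\mathbf k}}},\quad \mathbf j,\mathbf k\in\Gamma^{\mathsf{cc}}_n,$$ $$\langle \mathsf{SC}_{\mathbf j},\mathsf{SC}_{\mathbf k}\rangle_{\triangle,n}=\frac{\delta_{\mathbf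 j,\mathbf k}}{c^{(n)}_{\widehat{\mathbf k}}|\mathbf kG_2|}=\frac{\delta_{\mathbf j,\mathbf k}}{\omega^{(n)}_{\widehat{\mathbf k}}},\quad \mathbf j,\mathbf k\in\Gamma^{\mathsf{sc}}_n,$$ $$\langle \mathsf{CS}_{\mathbf j},\mathsf{CS}_{\mathbf k}\rangle_{\triangle,n}=\frac{\delta_{\mathbf j,\mathbf k}}{c^{(n)}_{\widehat{\mathbf k}}|\mathbf kG_2|}=\frac{\delta_{\mathbf j,\mathbf k}}{\omega^{(n)}_{\widehat{\mathbf k}}},\quad \mathbf j,\mathbf k\in\Gamma^{\mathsf{cs}}_n,$$ $$\langle \mathsf{SS}_{\mathbf j},\mathsf{SS}_{\mathbf k}\rangle_{\triangle,n}=\frac{\delta_{\mathbf j,\mathbf k}}{c^{(n)}_{\widehat{\mathbf k}}|\mathbf kG_2|}=\frac{\delta_{\mathbf j,\mathbf k}}{12},\quad \mathbf j,\mathbf k\in\Gamma^{\mathsf{ss}}_n.$$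
   Context: Let $\mathbb R^3_H=\{\mathbf t=(t_1,t_2,t_3)\in\mathbb R^3:t_1+t_2+t_3=0\}$, $\mathbb H^\dagger=\mathbb Z^3\cap\mathbb R^3_H$, and $\mathbb H=\{\mathbf j\in\mathbb H^\dagger: j_1\equiv j_2\equiv j_3 \pmod 3\}$. Define $\mathbf t\sigma_1=-(t_1,t_3,t_2)$, $\mathbf t\sigma_2=-(t_2,t_1,t_3)$, $\mathbf t\sigma_3=-(t_3,t_2,t_1)$, $\mathcal A_2=\{1,\sigma_1,\sigma_2,\sigma_3,\sigma_1\sigma_2,\sigma_2\sigma_1\}$, $\mathbf t(-\sigma)=-\mathbf t\sigma$, and $G_2=\{\pm\sigma:\sigma\in\mathcal A_2\}$ (order 12: all coordinate permutations, with or without a global sign change). $\mathbf kG_2$ is the orbit of $\mathbf k$ under $G_2$. Put $(-1)^{|\sigma|}=1$ for $\sigma\in\{\pm1,\pm\sigma_1\sigma_2,\pm\sigma_2\sigma_1\}$ and $(-1)^{|\sigma|}=-1$ for $\sigma\in\{\pm\sigma_1,\pm\sigma_2,\pm\sigma_3\}$. With $\phi_{\mathbf k}(\mathbf t)=e^{\frac{2\pi i}{3}\mathbf k\cdot\mathbf t}$, for $\mathbf k\in\mathbb H^\dagger$ define the generalized trigonometric functions $\mathsf{CC}_{\mathbf k}=\frac1{12}\sum_{\sigma\in\mathcal A_2}(\phi_{\mathbf k\sigma}+\phi_{-\mathbf k\sigma})$, $\mathsf{SC}_{\mathbf k}=\frac1{12i}\sum_{\sigma\in\mathcal A_2}(\phi_{\mathbf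 k\sigma}-\phi_{-\mathbf k\sigma})$, $\mathsf{CS}_{\mathbf k}=\frac1{12i}\sum_{\sigma\in\mathcal A_2}(-1)^{|\sigma|}(\phi_{\mathbf k\sigma}-\phi_{-\mathbf k\sigma})$, $\mathsf{SS}_{\mathbf k}=-\frac1{12}\sum_{\sigma\in\mathcal A_2}(-1)^{|\sigma|}(\phi_{\mathbf k\sigma}+\phi_{-\mathbf k\sigma})$. The triangle is $\triangle=\{\mathbf t\in\mathbb R^3_H:0\le t_2\le t_1\le -t_3\le 1\}$, and $\frac1{|\triangle|}\int_\triangle f(\mathbf t)\,d\mathbf t=4\int_0^{1/2}dt_2\int_{t_2}^{1-t_2}f(\mathbf t)\,dt_1$ with $t_3=-t_1-t_2$. Index sets: $\Upsilon_n=\{\mathbf j\in\mathbb H:0\le j_2\le j_1\le -j_3\le n\}$; $\Gamma_n^{\mathsf{cc}}=\{\mathbf k\in\mathbb H^\dagger:0\le k_2\le k_1\le k_3+n\}$, $\Gamma_n^{\mathsf{sc}}=\{\mathbf k\in\mathbb H^\dagger:0\le k_2<k_1<k_3+n\}$, $\Gamma_n^{\mathsf{cs}}=\{\mathbf k\in\mathbb H^\dagger:0<k_2\le k_1\le k_3+n\}$, $\Gamma_n^{\mathsf{ss}}=\{\mathbf k\in\mathbb H^\dagger:0<k_2<k_1<k_3+n\}$. For any integer $m\ge 0$, $\mathcal H_m^{\mathsf{cc}}=\mathrm{span}\{\mathsf{CC}_{\mathbf k}:\mathbf k\in\Gamma_m^{\mathsf{cc}}\}$. For $\mathbf j\in\mathbb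 H$ with $|j_1|,|j_2|,|j_3|\le n$, put $c^{(n)}_{\mathbf j}=1$ if all $|j_i|<n$, $c^{(n)}_{\mathbf j}=\frac13$ if $\mathbf j$ is a permutation of $(n,0,-n)$, and $c^{(n)}_{\mathbf j}=\frac12$ otherwise; and $\omega^{(n)}_{\mathbf j}=c^{(n)}_{\mathbf j}|\mathbf jG_2|$. (For $\mathbf k\in\Gamma_n^{\mathsf{cc}}$, $\widehat{\mathbf k}$ is such a point.) $\delta_{\mathbf j,\mathbf k}$ is the Kronecker delta. *)

theory Defs
  imports
    "HOL-Analysis.Analysis"
    "HOL-Library.Function_Algebras"
    "HOL-Number_Theory.Cong"
begin

section \<open>Homogeneous coordinates and index sets\<close>

definition R3H :: "(real ^ 3) set" where
  "R3H = {t. t $ 1 + t $ 2 + t $ 3 = 0}"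

definition Hdag :: "(int ^ 3) set" where
  "Hdag = {j. j $ 1 + j $ 2 + j $ 3 = 0}"

definition Hlat :: "(int ^ 3) set" where
  "Hlat = {j \<in> Hdag. [j $ 1 = j $ 2] (mod 3) \<and> [j $ 2 = j $ 3] (mod 3)}"

definition Upsilon :: "nat \<Rightarrow> (int ^ 3) set" where
  "Upsilon n = {j \<in> Hlat. 0 \<le> j $ 2 \<and> j $ 2 \<le> j $ 1 \<and> j $ 1 \<le> - j $ 3 \<and> - j $ 3 \<le> int n}"

definition Gamma_cc :: "nat \<Rightarrow> (int ^ 3) set" where
  "Gamma_cc n = {k \<in> Hdag. 0 \<le> k $ 2 \<and> k $ 2 \<le> k $ 1 \<and> k $ 1 \<le> k $ 3 + int n}"

definition Gamma_sc :: "nat \<Rightarrow> (int ^ 3) set" where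
  "Gamma_sc n = {k \<in> Hdag. 0 \<le> k $ 2 \<and> k $ 2 < k $ 1 \<and> k $ 1 < k $ 3 + int n}"

definition Gamma_cs :: "nat \<Rightarrow> (int ^ 3) set" where
  "Gamma_cs n = {k \<in> Hdag. 0 < k $ 2 \<and> k $ 2 \<le> k $ 1 \<and> k $ 1 \<le> k $ 3 + int n}"

definition Gamma_ss :: "nat \<Rightarrow> (int ^ 3) set" where
  "Gamma_ss n = {k \<in> Hdag. 0 < k $ 2 \<and> k $ 2 < k $ 1 \<and> k $ 1 < k $ 3 + int n}"

definition hat :: "int ^ 3 \<Rightarrow> int ^ 3" where
  "hat k = vector [k $ 3 - k $ 2, k $ 1 - k $ 3, k $ 2 - k $ 1]"


section \<open>The group \<open>G\<^sub>2\<close>\<close>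

text \<open>The group acts on the right, so the product \<open>\<sigma>\<^sub>1 \<sigma>\<^sub>2\<close> is the map
  \<open>sigma2 \<circ> sigma1\<close>. Negation of a map is the pointwise one of
  \<^theory>\<open>HOL-Library.Function_Algebras\<close>, i.e. \<open>(- \<sigma>) t = - \<sigma> t\<close>.\<close>

definition sigma1 :: "int ^ 3 \<Rightarrow> int ^ 3" where
  "sigma1 t = - vector [t $ 1, t $ 3, t $ 2]"

definition sigma2 :: "int ^ 3 \<Rightarrow> int ^ 3" where
  "sigma2 t = - vector [t $ 2, t $ 1, t $ 3]"

definition sigma3 :: "int ^ 3 \<Rightarrow> int ^ 3" where
  "sigma3 t = - vector [t $ 3, t $ 2, t $ 1]"

definition A2 :: "(int ^ 3 \<Rightarrow> int ^ 3) set" where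
  "A2 = {id, sigma1, sigma2, sigma3, sigma2 \<circ> sigma1, sigma1 \<circ> sigma2}"

definition G2 :: "(int ^ 3 \<Rightarrow> int ^ 3) set" where
  "G2 = A2 \<union> uminus ` A2"

definition G2_orbit :: "int ^ 3 \<Rightarrow> (int ^ 3) set" where
  "G2_orbit k = {\<sigma> k |\<sigma>. \<sigma> \<in> G2}"

text \<open>\<open>G2_sign \<sigma>\<close> is \<open>(-1)\<^sup>|\<^sup>\<sigma>\<^sup>|\<close>; it is meant for \<open>\<sigma> \<in> G2\<close> only.\<close>

definition G2_sign :: "(int ^ 3 \<Rightarrow> int ^ 3) \<Rightarrow> complex" where
  "G2_sign \<sigma> =
     (if \<sigma> \<in> {id, - id, sigma2 \<circ> sigma1, - (sigma2 \<circ> sigma1), sigma1 \<circ> sigma2, - (sigma1 \<circ> sigma2)}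
      then 1 else - 1)"


section \<open>Generalized trigonometric functions\<close>

definition rvec :: "int ^ 3 \<Rightarrow> real ^ 3" where
  "rvec k = (\<chi> i. real_of_int (k $ i))"

definition phi :: "int ^ 3 \<Rightarrow> real ^ 3 \<Rightarrow> complex" where
  "phi k t = exp (2 * of_real pi * \<i> / 3 * of_real (rvec k \<bullet> t))"

definition CC :: "int ^ 3 \<Rightarrow> real ^ 3 \<Rightarrow> complex" where
  "CC k t = 1 / 12 * (\<Sum>\<sigma>\<in>A2. phi (\<sigma> k) t + phi (- \<sigma> k) t)"

definition SC :: "int ^ 3 \<Rightarrow> real ^ 3 \<Rightarrow> complex" where
  "SC k t = 1 / (12 * \<i>) * (\<Sum>\<sigma>\<in>A2. phi (\<sigma> k) t - phi (- \<sigma> k) t)"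

definition CS :: "int ^ 3 \<Rightarrow> real ^ 3 \<Rightarrow> complex" where
  "CS k t = 1 / (12 * \<i>) * (\<Sum>\<sigma>\<in>A2. G2_sign \<sigma> * (phi (\<sigma> k) t - phi (- \<sigma> k) t))"

definition SS :: "int ^ 3 \<Rightarrow> real ^ 3 \<Rightarrow> complex" where
  "SS k t = - (1 / 12) * (\<Sum>\<sigma>\<in>A2. G2_sign \<sigma> * (phi (\<sigma> k) t + phi (- \<sigma> k) t))"

text \<open>Complex-linear span in the space of complex-valued functions; the library's
  \<^const>\<open>span\<close> is over the reals.\<close>

global_interpretation cfun: vector_space "\<lambda>(c :: complex) (f :: 'a \<Rightarrow> complex) t. c * f t"
  defines cfun_span = cfun.span
  by unfold_locales (auto simp: fun_eq_iff algebra_simps)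

definition H_cc :: "nat \<Rightarrow> (real ^ 3 \<Rightarrow> complex) set" where
  "H_cc m = cfun_span (CC ` Gamma_cc m)"


section \<open>The mean value over the triangle\<close>

definition triangle :: "(real ^ 3) set" where
  "triangle = {t \<in> R3H. 0 \<le> t $ 2 \<and> t $ 2 \<le> t $ 1 \<and> t $ 1 \<le> - t $ 3 \<and> - t $ 3 \<le> 1}"

text \<open>The plane \<^const>\<open>R3H\<close> carries the two-dimensional Lebesgue measure \<open>dt\<^sub>1 dt\<^sub>2\<close>, i.e. it is
  parametrized by its first two coordinates. Rescaling the measure does not change the mean
  value.\<close>

definition plane_pt :: "real \<times> real \<Rightarrow> real ^ 3" where
  "plane_pt p = vector [fst p, snd p, - fst p - snd p]"

definition triangle_mean :: "(real ^ 3 \<Rightarrow> complex) \<Rightarrow> complex" where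
  "triangle_mean f =
     1 / of_real (measure lborel (plane_pt -` triangle)) *
     (LINT p : plane_pt -` triangle | lborel. f (plane_pt p))"


section \<open>Weights and the discrete inner product\<close>

text \<open>Only meant for \<open>j\<close> in \<^const>\<open>Hlat\<close> with all \<open>\<bar>j $ i\<bar> \<le> n\<close>.\<close>

definition c_weight :: "nat \<Rightarrow> int ^ 3 \<Rightarrow> real" where
  "c_weight n j =
     (if \<forall>i. \<bar>j $ i\<bar> < int n then 1
      else if \<exists>p. p permutes (UNIV :: 3 set) \<and> j = (\<chi> i. vector [int n, 0, - int n] $ p i) then 1 / 3
      else 1 / 2)"

definition omega :: "nat \<Rightarrow> int ^ 3 \<Rightarrow> real" where
  "omega n j = c_weight n j * real (card (G2_orbit j))"

definition node :: "nat \<Rightarrow> int ^ 3 \<Rightarrow> real ^ 3" where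
  "node n j = rvec j /\<^sub>R real n"

definition triangle_inner ::
    "nat \<Rightarrow> (real ^ 3 \<Rightarrow> complex) \<Rightarrow> (real ^ 3 \<Rightarrow> complex) \<Rightarrow> complex" where
  "triangle_inner n f g =
     1 / of_nat n ^ 2 * (\<Sum>j\<in>Upsilon n. of_real (omega n j) * f (node n j) * cnj (g (node n j)))"


section \<open>Consistency checks\<close>

lemma finite_Upsilon: "finite (Upsilon n)"
proof -
  have "Upsilon n \<subseteq> (\<lambda>(a, b, c). vector [a, b, c]) `
      ({- int n..int n} \<times> {- int n..int n} \<times> {- int n..int n})"
  proof
    fix j assume "j \<in> Upsilon n"
    moreover have "j = vector [j $ 1, j $ 2, j $ 3]"
      by (simp add: vec_eq_iff forall_3)
    ultimately show "j \<in> (\<lambda>(a, b, c). vector [a, b, c]) `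
        ({- int n..int n} \<times> {- int n..int n} \<times> {- int n..int n})"
      by (intro image_eqI[of _ _ "(j $ 1, j $ 2, j $ 3)"]) (auto simp: Upsilon_def)
  qed
  then show ?thesis
    by (rule finite_subset) auto
qed

lemma plane_pt_triangle_iff:
  "plane_pt p \<in> triangle \<longleftrightarrow> snd p \<in> {0..1/2} \<and> fst p \<in> {snd p..1 - snd p}"
  by (auto simp: triangle_def plane_pt_def R3H_def)

lemma continuous_plane_pt: "continuous_on S plane_pt"
proof (rule continuous_on_vec_lambda[of S "\<lambda>i p. plane_pt p $ i", unfolded vec_lambda_eta])
  fix i :: 3
  show "continuous_on S (\<lambda>p. plane_pt p $ i)"
    using exhaust_3[of i] by (elim disjE) (simp_all add: plane_pt_def continuous_intros)
qed

lemma triangle_mean_iterated: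
  fixes f :: "real ^ 3 \<Rightarrow> complex"
  assumes f: "continuous_on triangle f"
  shows "triangle_mean f =
    4 * (LINT t2 : {0..1/2} | lborel. LINT t1 : {t2..1 - t2} | lborel. f (vector [t1, t2, - t1 - t2]))"
proof -
  define D where "D = plane_pt -` triangle"
  have D: "D = {p. 0 \<le> snd p} \<inter> {p. snd p \<le> 1/2} \<inter> {p. snd p \<le> fst p} \<inter> {p. fst p \<le> 1 - snd p}"
    by (auto simp: D_def plane_pt_triangle_iff)
  have "closed D"
    unfolding D by (intro closed_Int closed_Collect_le continuous_intros)
  moreover have "D \<subseteq> cbox (0, 0) (1, 1)"
    by (auto simp: D cbox_Pair_eq)
  ultimately have compact: "compact D"
    by (meson bounded_cbox bounded_subset compact_eq_bounded_closed)
  have ind: "indicator D (x, y) = (indicator {0..1/2} y * indicator {y..1 - y} x :: real)" for x y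
    by (auto simp: D indicator_def)
  have iter: "(LINT p : D | lborel. g p) =
      (LINT y : {0..1/2} | lborel. LINT x : {y..1 - y} | lborel. g (x, y))"
    if g: "continuous_on D g" for g :: "real \<times> real \<Rightarrow> complex"
  proof -
    have "integrable lborel (\<lambda>p. indicator D p *\<^sub>R g p)"
      using borel_integrable_compact[OF compact g] by (simp add: indicator_def if_distrib cong: if_cong)
    then have "integrable (lborel \<Otimes>\<^sub>M lborel) (\<lambda>(x, y). indicator D (x, y) *\<^sub>R g (x, y))"
      by (simp add: lborel_prod case_prod_unfold)
    from lborel_pair.integral_snd[OF this]
    have "(LINT p | lborel. indicator D p *\<^sub>R g p) =
        (LINT y | lborel. LINT x | lborel. indicator D (x, y) *\<^sub>R g (x, y))"
      by (simp add: lborel_prod case_prod_unfold)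
    then show ?thesis
      by (simp add: set_lebesgue_integral_def ind mult.assoc flip: scaleR_scaleR)
  qed
  have "continuous_on D (\<lambda>p. f (plane_pt p))"
    by (rule continuous_on_compose2[OF f continuous_plane_pt]) (auto simp: D_def)
  note int = iter[OF this]
  have inner: "(LINT x : {y..1 - y} | lborel. 1 :: complex) = of_real (1 - 2 * y)" if "y \<in> {0..1/2}" for y
    using that by (simp add: set_lebesgue_integral_def scaleR_conv_of_real)
  have "(LINT p : D | lborel. 1 :: complex) = (LINT y : {0..1/2} | lborel. of_real (1 - 2 * y))"
    unfolding iter[OF continuous_on_const]
    by (rule set_lebesgue_integral_cong) (use inner in auto)
  also have "\<dots> = of_real (LINT y : {0..1/2} | lborel. 1 - 2 * y)"
    by (simp add: set_lebesgue_integral_def flip: integral_complex_of_real of_real_mult)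
      (simp add: scaleR_conv_of_real)
  also have "(LINT y : {0..1/2} | lborel. 1 - 2 * y) = (1/2 - (1/2)\<^sup>2) - (0 - 0\<^sup>2 :: real)"
    unfolding set_lebesgue_integral_def
    by (rule integral_FTC_atLeastAtMost)
      (auto intro!: derivative_eq_intros continuous_intros
        simp: has_real_derivative_iff_has_vector_derivative[symmetric])
  also have "\<dots> = 1 / 4"
    by (simp add: power2_eq_square)
  finally have area: "of_real (measure lborel D) = (1 / 4 :: complex)"
    using compact by (simp add: set_lebesgue_integral_def borel_compact scaleR_conv_of_real)
  show ?thesis
    unfolding triangle_mean_def D_def[symmetric] int area by (simp add: plane_pt_def)
qed

end

theory Submission
  imports Defs
begin

text \<open>
  The map \<open>rot\<close>, a rotation of the plane by a right angle combined with a scaling by \<open>\<surd>3\<close>, carries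
  the lattice \<open>Hdag\<close> onto \<open>Hlat\<close> and \<open>Gamma_cc n\<close> onto \<open>Upsilon n\<close>. In these coordinates frequencies
  and nodes live in the same finite group \<open>Hdag / n Hdag\<close>, the exponentials become its characters,
  and \<open>Gamma_cc n\<close> is a fundamental domain of the affine group generated by \<open>G2\<close> and the
  translations by \<open>n Hdag\<close>. The weight of a node is the number of residue classes in its orbit, that
  is 12 divided by the order of its stabilizer modulo \<open>n\<close>, so the weighted sum over the nodes is the
  sum over the whole finite group, and character orthogonality evaluates it. Each of the four
  families projects the exponentials to a sign character of \<open>G2\<close>, and the strict inequalities in its
  index set say that this character is trivial on the stabilizers.

  The mean of \<open>CC k\<close> over the triangle vanishes for \<open>k \<noteq> 0\<close>, because \<open>CC k\<close> is an eigenfunction of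
  the Laplacian with vanishing normal derivative on the boundary. The only multiple of \<open>n\<close> in
  \<open>Gamma_cc (2 * n - 1)\<close> is zero, so no frequency of \<open>H_cc (2 * n - 1)\<close> is aliased to a constant.
\<close>

section \<open>The group\<close>

lemma vec3_eq_iff: "x = y \<longleftrightarrow> x $ 1 = y $ 1 \<and> x $ 2 = y $ 2 \<and> x $ 3 = y $ 3" for x y :: "'a ^ 3"
  by (simp add: vec_eq_iff forall_3)

lemma sigma_nth [simp]:
  "sigma1 x $ 1 = - x $ 1" "sigma1 x $ 2 = - x $ 3" "sigma1 x $ 3 = - x $ 2"
  "sigma2 x $ 1 = - x $ 2" "sigma2 x $ 2 = - x $ 1" "sigma2 x $ 3 = - x $ 3"
  "sigma3 x $ 1 = - x $ 3" "sigma3 x $ 2 = - x $ 2" "sigma3 x $ 3 = - x $ 1"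
  by (simp_all add: sigma1_def sigma2_def sigma3_def)

lemma permutes_3:
  fixes p :: "3 \<Rightarrow> 3"
  shows "p permutes UNIV \<longleftrightarrow> (p 1, p 2, p 3) \<in> {(1,2,3), (1,3,2), (2,1,3), (2,3,1), (3,1,2), (3,2,1)}"
proof -
  have "p permutes UNIV \<longleftrightarrow> inj p"
  proof
    assume "inj p"
    then have "bij_betw p UNIV UNIV"
      by (simp add: bij_def finite_UNIV_inj_surj)
    then show "p permutes UNIV"
      by (rule bij_imp_permutes) simp
  qed (rule permutes_inj)
  also have "\<dots> \<longleftrightarrow> p 1 \<noteq> p 2 \<and> p 1 \<noteq> p 3 \<and> p 2 \<noteq> p 3"
    by (simp add: inj_on_def forall_3) metis
  also have "\<dots> \<longleftrightarrow> (p 1, p 2, p 3) \<in> {(1,2,3), (1,3,2), (2,1,3), (2,3,1), (3,1,2), (3,2,1)}"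
    using exhaust_3[of "p 1"] exhaust_3[of "p 2"] exhaust_3[of "p 3"] by (elim disjE) simp_all
  finally show ?thesis .
qed

text \<open>The list of twelve maps suits case distinctions, whereas signed permutations are closed
  under composition and inversion without a multiplication table. Having both descriptions avoids
  144 cases in \<open>G2_comp\<close>.\<close>

lemma G2_iff: "g \<in> G2 \<longleftrightarrow> (\<exists>s \<in> {1, - 1}. \<exists>p. p permutes UNIV \<and> g = (\<lambda>x. \<chi> i. s * x $ p i))"
  (is "_ \<longleftrightarrow> ?R g")
proof
  have perm: "\<exists>p. p permutes (UNIV :: 3 set) \<and> p 1 = a \<and> p 2 = b \<and> p 3 = c"
    if "(a, b, c) \<in> {(1,2,3), (1,3,2), (2,1,3), (2,3,1), (3,1,2), (3,2,1)}" for a b c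
    using that by (intro exI[of _ "\<lambda>i. if i = 1 then a else if i = 2 then b else c"]) (auto simp: permutes_3)
  have *: "?R g" if s: "s \<in> {1, - 1}" and abc:
    "(a, b, c) \<in> {(1,2,3), (1,3,2), (2,1,3), (2,3,1), (3,1,2), (3,2,1)}"
    and g: "\<And>x. g x = vector [s * x $ a, s * x $ b, s * x $ c]" for s a b c g
  proof -
    obtain p where "p permutes UNIV" "p 1 = a" "p 2 = b" "p 3 = c"
      using perm[OF abc] by blast
    with s g show ?thesis
      by (intro bexI[of _ s] exI[of _ p]) (auto simp: fun_eq_iff vec3_eq_iff)
  qed
  have e0: "?R (id)"
    by (rule *[of 1 1 2 3]) (simp_all add: vec3_eq_iff)
  have e1: "?R (sigma1)"
    by (rule *[of "-1" 1 3 2]) (simp_all add: vec3_eq_iff)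
  have e2: "?R (sigma2)"
    by (rule *[of "-1" 2 1 3]) (simp_all add: vec3_eq_iff)
  have e3: "?R (sigma3)"
    by (rule *[of "-1" 3 2 1]) (simp_all add: vec3_eq_iff)
  have e4: "?R (sigma2 \<circ> sigma1)"
    by (rule *[of 1 3 1 2]) (simp_all add: vec3_eq_iff)
  have e5: "?R (sigma1 \<circ> sigma2)"
    by (rule *[of 1 2 3 1]) (simp_all add: vec3_eq_iff)
  have e6: "?R (- id)"
    by (rule *[of "-1" 1 2 3]) (simp_all add: vec3_eq_iff)
  have e7: "?R (- sigma1)"
    by (rule *[of 1 1 3 2]) (simp_all add: vec3_eq_iff)
  have e8: "?R (- sigma2)"
    by (rule *[of 1 2 1 3]) (simp_all add: vec3_eq_iff)
  have e9: "?R (- sigma3)"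
    by (rule *[of 1 3 2 1]) (simp_all add: vec3_eq_iff)
  have e10: "?R (- (sigma2 \<circ> sigma1))"
    by (rule *[of "-1" 3 1 2]) (simp_all add: vec3_eq_iff)
  have e11: "?R (- (sigma1 \<circ> sigma2))"
    by (rule *[of "-1" 2 3 1]) (simp_all add: vec3_eq_iff)
  assume "g \<in> G2"
  then have "g \<in> {id, sigma1, sigma2, sigma3, sigma2 \<circ> sigma1, sigma1 \<circ> sigma2, - id, - sigma1, - sigma2, - sigma3,
      - (sigma2 \<circ> sigma1), - (sigma1 \<circ> sigma2)}"
    by (auto simp: G2_def A2_def)
  then show "?R g"
    using e0 e1 e2 e3 e4 e5 e6 e7 e8 e9 e10 e11 by (elim insertE emptyE; hypsubst)
next
  assume "?R g"
  then obtain s p where g: "g = (\<lambda>x. \<chi> i. s * x $ p i)"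
    and sp: "s = 1 \<or> s = - 1" "(p 1, p 2, p 3) \<in> {(1,2,3), (1,3,2), (2,1,3), (2,3,1), (3,1,2), (3,2,1)}"
    unfolding permutes_3 by blast
  have "g = id" if "s = 1" "p 1 = 1" "p 2 = 2" "p 3 = 3"
    using that g by (simp add: fun_eq_iff vec3_eq_iff)
  moreover
  have "g = sigma1" if "s = - 1" "p 1 = 1" "p 2 = 3" "p 3 = 2"
    using that g by (simp add: fun_eq_iff vec3_eq_iff)
  moreover
  have "g = sigma2" if "s = - 1" "p 1 = 2" "p 2 = 1" "p 3 = 3"
    using that g by (simp add: fun_eq_iff vec3_eq_iff)
  moreover
  have "g = sigma3" if "s = - 1" "p 1 = 3" "p 2 = 2" "p 3 = 1"
    using that g by (simp add: fun_eq_iff vec3_eq_iff)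
  moreover
  have "g = sigma2 \<circ> sigma1" if "s = 1" "p 1 = 3" "p 2 = 1" "p 3 = 2"
    using that g by (simp add: fun_eq_iff vec3_eq_iff)
  moreover
  have "g = sigma1 \<circ> sigma2" if "s = 1" "p 1 = 2" "p 2 = 3" "p 3 = 1"
    using that g by (simp add: fun_eq_iff vec3_eq_iff)
  moreover
  have "g = - id" if "s = - 1" "p 1 = 1" "p 2 = 2" "p 3 = 3"
    using that g by (simp add: fun_eq_iff vec3_eq_iff)
  moreover
  have "g = - sigma1" if "s = 1" "p 1 = 1" "p 2 = 3" "p 3 = 2"
    using that g by (simp add: fun_eq_iff vec3_eq_iff)
  moreover
  have "g = - sigma2" if "s = 1" "p 1 = 2" "p 2 = 1" "p 3 = 3"
    using that g by (simp add: fun_eq_iff vec3_eq_iff)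
  moreover
  have "g = - sigma3" if "s = 1" "p 1 = 3" "p 2 = 2" "p 3 = 1"
    using that g by (simp add: fun_eq_iff vec3_eq_iff)
  moreover
  have "g = - (sigma2 \<circ> sigma1)" if "s = - 1" "p 1 = 3" "p 2 = 1" "p 3 = 2"
    using that g by (simp add: fun_eq_iff vec3_eq_iff)
  moreover
  have "g = - (sigma1 \<circ> sigma2)" if "s = - 1" "p 1 = 2" "p 2 = 3" "p 3 = 1"
    using that g by (simp add: fun_eq_iff vec3_eq_iff)
  ultimately have "g \<in> {id, sigma1, sigma2, sigma3, sigma2 \<circ> sigma1, sigma1 \<circ> sigma2, - id, - sigma1, - sigma2, - sigma3,
      - (sigma2 \<circ> sigma1), - (sigma1 \<circ> sigma2)}"
    using sp unfolding insert_iff empty_iff prod.inject by (smt (verit))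
  then show "g \<in> G2"
    unfolding G2_def A2_def by auto
qed

lemma G2_elements: "G2 = {id, sigma1, sigma2, sigma3, sigma2 \<circ> sigma1, sigma1 \<circ> sigma2,
    - id, - sigma1, - sigma2, - sigma3,
      - (sigma2 \<circ> sigma1), - (sigma1 \<circ> sigma2)}"
  by (auto simp: G2_def A2_def)

lemma finite_G2 [simp]: "finite G2"
  by (simp add: G2_elements)

lemma
  shows card_G2: "card G2 = 12"
    and sum_A2: "(\<Sum>\<sigma>\<in>A2. (f \<sigma> :: complex)) = f id + f sigma1 + f sigma2 + f sigma3
      + f (sigma2 \<circ> sigma1) + f (sigma1 \<circ> sigma2)"
    and A2_Int_uminus_A2: "A2 \<inter> uminus ` A2 = {}"
    and G2_sign_A2: "G2_sign id = 1" "G2_sign sigma1 = - 1" "G2_sign sigma2 = - 1" "G2_sign sigma3 = - 1"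
      "G2_sign (sigma2 \<circ> sigma1) = 1" "G2_sign (sigma1 \<circ> sigma2) = 1"
proof -
  \<comment> \<open>The twelve images of this vector differ already in their first two coordinates,
    so distinctness of the maps reduces to distinctness of pairs of numbers.\<close>
  define v :: "int ^ 3" where "v = vector [1, 2, 4]"
  have v: "v $ 1 = 1" "v $ 2 = 2" "v $ 3 = 4"
    by (simp_all add: v_def)
  have neq: "g v \<noteq> h v \<Longrightarrow> g \<noteq> h" for g h :: "int ^ 3 \<Rightarrow> int ^ 3"
    by auto
  have dist: "distinct [id, sigma1, sigma2, sigma3, sigma2 \<circ> sigma1, sigma1 \<circ> sigma2,
      - id, - sigma1, - sigma2, - sigma3, - (sigma2 \<circ> sigma1), - (sigma1 \<circ> sigma2)]"
    by (rule distinct_map[of "\<lambda>g. (g v $ 1, g v $ 2)", THEN iffD1, THEN conjunct1]) (simp add: v)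
  show "card G2 = 12"
    "(\<Sum>\<sigma>\<in>A2. (f \<sigma> :: complex)) = f id + f sigma1 + f sigma2 + f sigma3
      + f (sigma2 \<circ> sigma1) + f (sigma1 \<circ> sigma2)"
    using dist by (auto simp: G2_elements A2_def)
  show "A2 \<inter> uminus ` A2 = {}"
    using dist by (auto simp: A2_def)
  \<comment> \<open>The six excluded pairs are the values at \<open>v\<close> of the maps of sign
    1.\<close>
  have "G2_sign g = - 1"
    if "(g v $ 1, g v $ 2) \<notin> {(1, 2), (- 1, - 2), (4, 1), (- 4, - 1), (2, 4), (- 2, - 4)}" for g
  proof -
    have "g \<notin> {id, - id, sigma2 \<circ> sigma1, - (sigma2 \<circ> sigma1), sigma1 \<circ> sigma2, - (sigma1 \<circ> sigma2)}"
      using that by (auto simp: v)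
    then show ?thesis
      unfolding G2_sign_def by (rule if_not_P)
  qed
  from this[of sigma1] this[of sigma2] this[of sigma3]
  show "G2_sign sigma1 = - 1" "G2_sign sigma2 = - 1" "G2_sign sigma3 = - 1"
    by (simp_all add: v)
  show "G2_sign id = 1" "G2_sign (sigma2 \<circ> sigma1) = 1" "G2_sign (sigma1 \<circ> sigma2) = 1"
    by (simp_all add: G2_sign_def)
qed

lemma id_in_G2 [simp]: "id \<in> G2"
  by (simp add: G2_elements)

lemma G2_comp:
  assumes "g \<in> G2" "h \<in> G2"
  shows "g \<circ> h \<in> G2"
proof -
  obtain s p where 1: "s \<in> {1, - 1}" "p permutes UNIV" "g = (\<lambda>x. \<chi> i. s * x $ p i)"
    using assms(1) unfolding G2_iff by blast
  obtain t q where 2: "t \<in> {1, - 1}" "q permutes UNIV" "h = (\<lambda>x. \<chi> i. t * x $ q i)"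
    using assms(2) unfolding G2_iff by blast
  have "q \<circ> p permutes UNIV"
    using 1(2) 2(2) by (rule permutes_compose)
  then show ?thesis
    unfolding G2_iff using 1(1) 2(1)
    by (intro bexI[of _ "s * t"] exI[of _ "q \<circ> p"]) (auto simp: 1 2 fun_eq_iff vec_eq_iff)
qed

lemma G2_inverse:
  assumes "g \<in> G2"
  obtains h where "h \<in> G2" "h \<circ> g = id" "g \<circ> h = id"
proof -
  obtain s p where 1: "s = 1 \<or> s = - 1" "p permutes UNIV" "g = (\<lambda>x. \<chi> i. s * x $ p i)"
    using assms unfolding G2_iff by blast
  define h where "h = (\<lambda>x :: int ^ 3. \<chi> i. s * x $ inv p i)"
  have "h \<in> G2"
    unfolding G2_iff h_def using permutes_inv[OF 1(2)] 1(1) by blast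
  moreover have "h \<circ> g = id" "g \<circ> h = id"
    using 1(1) by (auto simp: 1(3) h_def fun_eq_iff vec_eq_iff permutes_inverses[OF 1(2)])
  ultimately show ?thesis
    by (rule that)
qed

lemma G2_comp_bij:
  assumes "g \<in> G2"
  shows "bij_betw (\<lambda>h. g \<circ> h) G2 G2" "bij_betw (\<lambda>h. h \<circ> g) G2 G2"
proof -
  obtain g' where g': "g' \<in> G2" "g' \<circ> g = id" "g \<circ> g' = id"
    using G2_inverse[OF assms] .
  show "bij_betw (\<lambda>h. g \<circ> h) G2 G2"
    using g' assms by (intro bij_betw_byWitness[where f' = "\<lambda>h. g' \<circ> h"])
      (auto simp: comp_assoc[symmetric] G2_comp)
  show "bij_betw (\<lambda>h. h \<circ> g) G2 G2"
    using g' assms by (intro bij_betw_byWitness[where f' = "\<lambda>h. h \<circ> g'"])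
      (auto simp: comp_assoc G2_comp)
qed

lemma sum_G2_comp:
  assumes "g \<in> G2"
  shows "(\<Sum>h\<in>G2. f (g \<circ> h)) = sum f G2" "(\<Sum>h\<in>G2. f (h \<circ> g)) = sum f G2"
  using sum.reindex_bij_betw[OF G2_comp_bij(1)[OF assms]] sum.reindex_bij_betw[OF G2_comp_bij(2)[OF assms]]
  by auto

text \<open>The trigonometric functions are defined by sums over \<open>A2\<close> that pair each
  map with its negative; sums over the whole group can be reindexed by
  \<open>sum_G2_comp\<close>.\<close>

lemma sum_G2_A2: "(\<Sum>g\<in>G2. f g) = (\<Sum>g\<in>A2. f g + (f (- g) :: complex))"
proof -
  have "(\<Sum>g\<in>G2. f g) = (\<Sum>g\<in>A2. f g) + (\<Sum>g\<in>uminus ` A2. f g)"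
    unfolding G2_def using A2_Int_uminus_A2 by (intro sum.union_disjoint) (auto simp: A2_def)
  also have "(\<Sum>g\<in>uminus ` A2. f g) = (\<Sum>g\<in>A2. f (- g))"
    by (subst sum.reindex) (auto simp: inj_on_def)
  finally show ?thesis
    by (simp add: sum.distrib)
qed


section \<open>The fundamental domain\<close>

lemma G2_add:
  assumes "g \<in> G2"
  shows "g (x + y) = g x + g y"
proof -
  obtain s p where "g = (\<lambda>x. \<chi> i. s * x $ p i)"
    using assms unfolding G2_iff by blast
  then show "g (x + y) = g x + g y"
    by (simp add: vec_eq_iff algebra_simps)
qed

lemma G2_Hdag: "g \<in> G2 \<Longrightarrow> x \<in> Hdag \<Longrightarrow> g x \<in> Hdag"
  unfolding G2_elements by (elim insertE emptyE) (simp_all add: Hdag_def)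

lemma mem_G2_orbit: "y \<in> G2_orbit x \<longleftrightarrow> (\<exists>g\<in>G2. g x = y)"
  by (auto simp: G2_orbit_def)

lemma G2_orbit_eq_image: "G2_orbit x = (\<lambda>g. g x) ` G2"
  by (auto simp: G2_orbit_def)

lemma finite_G2_orbit: "finite (G2_orbit x)"
  by (simp add: G2_orbit_eq_image)

lemma G2_orbit_apply:
  assumes "g \<in> G2"
  shows "G2_orbit (g x) = G2_orbit x"
proof -
  have "(\<lambda>h. h \<circ> g) ` G2 = G2"
    using G2_comp_bij(2)[OF assms] by (simp add: bij_betw_def)
  then have "(\<lambda>h. h x) ` (\<lambda>h. h \<circ> g) ` G2 = G2_orbit x"
    by (simp add: G2_orbit_eq_image)
  then show ?thesis
    by (simp add: G2_orbit_eq_image image_image)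
qed

text \<open>The maps taking \<open>x\<close> to \<open>y\<close> form a coset of the stabilizer of
  \<open>x\<close>; composing with the inverse of one of them carries the coset to the
  stabilizer.\<close>

lemma card_G2_transporter:
  assumes "y \<in> G2_orbit x"
  shows "card {g \<in> G2. g x = y} = card {g \<in> G2. g x = x}"
proof -
  obtain h where h: "h \<in> G2" "h x = y"
    using assms by (auto simp: mem_G2_orbit)
  obtain h' where h': "h' \<in> G2" "h' \<circ> h = id" "h \<circ> h' = id"
    using G2_inverse[OF h(1)] .
  have 1: "h' (h z) = z" "h (h' z) = z" for z
    using h'(2,3) by (auto simp: fun_eq_iff)
  have "bij_betw (\<lambda>g. h' \<circ> g) {g \<in> G2. g x = y} {g \<in> G2. g x = x}"
    using h(2) 1(1)[of x] by (intro bij_betw_byWitness[where f' = "\<lambda>g. h \<circ> g"])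
      (auto simp: 1 comp_assoc[symmetric] h' h G2_comp)
  then show ?thesis
    by (rule bij_betw_same_card)
qed

text \<open>Orbit-stabilizer theorem: the group splits into the fibres of
  \<open>g \<mapsto> g x\<close>, all of the same size.\<close>

lemma card_G2_orbit: "card (G2_orbit x) * card {g \<in> G2. g x = x} = 12"
proof -
  have "G2 = (\<Union>y\<in>G2_orbit x. {g \<in> G2. g x = y})"
    by (auto simp: mem_G2_orbit)
  then have "12 = card (\<Union>y\<in>G2_orbit x. {g \<in> G2. g x = y})"
    by (simp add: card_G2)
  also have "\<dots> = (\<Sum>y\<in>G2_orbit x. card {g \<in> G2. g x = y})"
    by (rule card_UN_disjoint) (auto simp: finite_G2_orbit)
  also have "\<dots> = card (G2_orbit x) * card {g \<in> G2. g x = x}"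
    by (simp add: card_G2_transporter)
  finally show ?thesis
    by simp
qed

section \<open>Congruence modulo \<open>n\<close> and representatives in the fundamental
  domain\<close>

definition veccong :: "nat \<Rightarrow> int ^ 3 \<Rightarrow> int ^ 3 \<Rightarrow> bool" where
  "veccong n x y \<longleftrightarrow> (\<forall>i. int n dvd x $ i - y $ i)"

lemma veccong_refl [simp]: "veccong n x x"
  by (simp add: veccong_def)

lemma veccong_sym: "veccong n x y \<Longrightarrow> veccong n y x"
  by (simp add: veccong_def dvd_diff_commute)

lemma veccong_trans: "veccong n x y \<Longrightarrow> veccong n y z \<Longrightarrow> veccong n x z"
  unfolding veccong_def by (metis diff_add_cancel add_diff_eq dvd_add)

lemma veccong_G2:
  assumes "g \<in> G2" "veccong n x y"
  shows "veccong n (g x) (g y)"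
proof -
  obtain s p where g: "g = (\<lambda>x. \<chi> i. s * x $ p i)"
    using assms unfolding G2_iff by blast
  show ?thesis
    using assms(2) by (simp add: g veccong_def flip: right_diff_distrib)
qed

lemma veccong_G2_iff:
  assumes "g \<in> G2"
  shows "veccong n (g x) (g y) \<longleftrightarrow> veccong n x y"
proof -
  obtain h where h: "h \<in> G2" "h \<circ> g = id"
    using G2_inverse[OF assms] .
  have "h (g z) = z" for z
    using h(2) by (auto simp: fun_eq_iff)
  then show ?thesis
    using veccong_G2[OF assms] veccong_G2[OF h(1), of n "g x" "g y"] by auto
qed

text \<open>The coordinates sum to zero, so up to a global sign two of them are nonnegative and one
  is nonpositive; a permutation puts the latter last and sorts the others.\<close>

lemma G2_sort:
  assumes "y \<in> Hdag"
  obtains h where "h \<in> G2" "0 \<le> h y $ 2" "h y $ 2 \<le> h y $ 1"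
proof -
  have "\<exists>h\<in>G2. 0 \<le> h y $ 2 \<and> h y $ 2 \<le> h y $ 1"
    using assms unfolding G2_elements Hdag_def by simp (smt (verit))
  with that show ?thesis
    by blast
qed

text \<open>The inequalities cut out a closed Weyl chamber of the reflection group
  \<open>G2\<close>, and such a chamber contains only one point of each orbit.\<close>

lemma G2_sorted_unique:
  assumes "g \<in> G2" "x \<in> Hdag" "0 \<le> x $ 2" "x $ 2 \<le> x $ 1"
    and "0 \<le> g x $ 2" "g x $ 2 \<le> g x $ 1"
  shows "g x = x"
  using assms unfolding G2_elements Hdag_def
  by (elim insertE emptyE) (simp_all add: vec3_eq_iff)

text \<open>A representative of least Euclidean norm lies in the fundamental domain.\<close>

lemma Gamma_cc_representative:
  assumes "n \<ge> 1" "x \<in> Hdag"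
  obtains g k where "g \<in> G2" "k \<in> Gamma_cc n" "veccong n (g x) k"
proof -
  define E :: "int ^ 3 \<Rightarrow> nat" where "E y = nat ((y $ 1)\<^sup>2 + (y $ 2)\<^sup>2 + (y $ 3)\<^sup>2)" for y
  have E_G2: "E (h y) = E y" if "h \<in> G2" for h y
    using that unfolding G2_elements by (elim insertE emptyE) (simp_all add: E_def algebra_simps)
  define P where "P y \<longleftrightarrow> y \<in> Hdag \<and> (\<exists>g\<in>G2. veccong n (g x) y)" for y
  have "P x"
    unfolding P_def using assms(2) by (intro conjI bexI[of _ id]) auto
  then obtain y where y: "P y" "\<And>z. P z \<Longrightarrow> E y \<le> E z"
    using ex_has_least_nat[of P x E] by blast
  obtain g where g: "g \<in> G2" "veccong n (g x) y"
    using y(1) by (auto simp: P_def)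
  obtain h where h: "h \<in> G2" "0 \<le> h y $ 2" "h y $ 2 \<le> h y $ 1"
    using G2_sort[of y] y(1) unfolding P_def by blast
  define k where "k = h y"
  have k: "k \<in> Hdag"
    using y(1) h(1) by (simp add: P_def k_def G2_Hdag)
  have hg: "h \<circ> g \<in> G2" "veccong n ((h \<circ> g) x) k"
    using g h(1) by (simp_all add: G2_comp k_def veccong_G2)
  \<comment> \<open>Passing from \<open>k\<close> to \<open>z\<close> adds
    \<open>2 n (n - (k1 - k3))\<close> to the squared norm, so minimality forces the remaining wall
    inequality.\<close>
  define z :: "int ^ 3" where "z = vector [k $ 1 - int n, k $ 2, k $ 3 + int n]"
  have "veccong n k z"
    by (simp add: veccong_def z_def forall_3)
  then have "veccong n ((h \<circ> g) x) z"
    using hg(2) by (rule veccong_trans[rotated])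
  then have "P z"
    unfolding P_def using k hg(1) by (intro conjI bexI[of _ "h \<circ> g"]) (auto simp: z_def Hdag_def)
  then have "E k \<le> E z"
    using y(2)[of z] E_G2[OF h(1), of y] by (simp add: k_def)
  then have "(k $ 1)\<^sup>2 + (k $ 2)\<^sup>2 + (k $ 3)\<^sup>2 \<le> (z $ 1)\<^sup>2 + (z $ 2)\<^sup>2 + (z $ 3)\<^sup>2"
    by (simp add: E_def nat_le_eq_zle)
  then have "0 \<le> 2 * int n * (int n - (k $ 1 - k $ 3))"
    by (simp add: z_def power2_eq_square algebra_simps)
  then have "k $ 1 - k $ 3 \<le> int n"
    using assms(1) by (simp add: zero_le_mult_iff)
  then have "k \<in> Gamma_cc n"
    using k h by (simp add: Gamma_cc_def k_def)
  with hg that show ?thesis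
    by blast
qed

text \<open>Bounding all coordinate differences defines a hexagon invariant under \<open>G2\<close>;
  it contains \<open>Gamma_cc n\<close> because the largest difference there is
  \<open>k $ 1 - k $ 3\<close>.\<close>

lemma G2_Gamma_diff_le:
  assumes "g \<in> G2" "k \<in> Gamma_cc n"
  shows "\<bar>g k $ i - g k $ l\<bar> \<le> int n"
proof -
  obtain s p where g: "s = 1 \<or> s = - 1" "g = (\<lambda>x. \<chi> i. s * x $ p i)"
    using assms unfolding G2_iff by blast
  have "\<bar>k $ i - k $ l\<bar> \<le> int n" for i l
    using assms(2) exhaust_3[of i] exhaust_3[of l] by (auto simp: Gamma_cc_def Hdag_def)
  from this[of "p i" "p l"] show ?thesis
    using g by auto
qed

text \<open>A point of the fundamental domain is congruent to another point of the hexagon only along the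
  wall \<open>k\<^sub>1 - k\<^sub>3 = n\<close>; the last alternative occurs at the vertex \<open>(n/3, n/3, -2n/3)\<close> only.\<close>

lemma Gamma_cc_veccong_cases:
  assumes "n \<ge> 1" "k \<in> Gamma_cc n" "x \<in> Hdag" "\<And>i l. \<bar>x $ i - x $ l\<bar> \<le> int n" "veccong n x k"
  shows "x = k \<or> (k $ 1 - k $ 3 = int n \<and> x = vector [k $ 3, k $ 2, k $ 1])
    \<or> (k $ 2 - k $ 3 = int n \<and> x = vector [k $ 1, k $ 3, k $ 2])"
proof -
  define N where "N = int n"
  have N: "N > 0"
    using assms(1) by (simp add: N_def)
  have "\<exists>v. x $ i - k $ i = N * v" for i
    using assms(5) by (auto simp: veccong_def N_def dvd_def)
  then obtain a b c where abc: "x $ 1 = k $ 1 + N * a" "x $ 2 = k $ 2 + N * b" "x $ 3 = k $ 3 + N * c"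
    by (metis add.commute diff_add_cancel)
  have k: "k $ 1 + k $ 2 + k $ 3 = 0" "0 \<le> k $ 2" "k $ 2 \<le> k $ 1" "k $ 1 \<le> k $ 3 + N"
    using assms(2) by (auto simp: Gamma_cc_def Hdag_def N_def)
  have x: "x $ 1 + x $ 2 + x $ 3 = 0"
    using assms(3) by (simp add: Hdag_def)
  have "N * (a + b + c) = 0"
    using x k(1) by (simp add: abc algebra_simps)
  then have sum0: "a + b + c = 0"
    using N by simp
  have dx: "\<bar>x $ 1 - x $ 2\<bar> \<le> N" "\<bar>x $ 2 - x $ 3\<bar> \<le> N" "\<bar>x $ 1 - x $ 3\<bar> \<le> N"
    using assms(4) by (auto simp: N_def)
  have bound: "\<bar>u - v\<bar> \<le> 2" if "\<bar>p - q\<bar> \<le> N" "\<bar>(p + N * u) - (q + N * v)\<bar> \<le> N" for p q u v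
  proof -
    have "\<bar>N * (u - v)\<bar> \<le> 2 * N"
      using that by (simp add: algebra_simps)
    then have "N * \<bar>u - v\<bar> \<le> N * 2"
      using N by (simp add: abs_mult mult.commute)
    then show ?thesis
      using N by simp
  qed
  have "\<bar>a - b\<bar> \<le> 2" "\<bar>b - c\<bar> \<le> 2" "\<bar>a - c\<bar> \<le> 2"
    using bound[of "k $ 1" "k $ 2" a b] bound[of "k $ 2" "k $ 3" b c] bound[of "k $ 1" "k $ 3" a c]
      dx k unfolding abc by auto
  \<comment> \<open>Apart from zero, the integer triples with sum zero and pairwise differences at
    most 2 are the six permutations of \<open>(1, -1, 0)\<close>.\<close>
  with sum0 have "(a, b, c) \<in> {(0,0,0), (1,-1,0), (1,0,-1), (0,1,-1), (-1,1,0), (-1,0,1), (0,-1,1)}"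
    by simp (smt (verit))
  then show ?thesis
    using dx k x N unfolding vec3_eq_iff N_def[symmetric]
    by (elim insertE emptyE; simp add: abc; smt (verit))
qed


section \<open>Weights and folding\<close>

text \<open>Both wall alternatives are mirror images of \<open>k\<close>, under
  \<open>- sigma3\<close> and \<open>- sigma1\<close>. Hence \<open>j\<close> and \<open>k\<close>
  lie in one \<open>G2\<close> orbit, of which the chamber contains only one point.\<close>

lemma Gamma_cc_veccong_unique:
  assumes "n \<ge> 1" "j \<in> Gamma_cc n" "k \<in> Gamma_cc n" "g \<in> G2" "veccong n (g j) k"
  shows "j = k"
proof -
  have jk: "j \<in> Hdag" "k \<in> Hdag" "0 \<le> j $ 2" "j $ 2 \<le> j $ 1" "0 \<le> k $ 2" "k $ 2 \<le> k $ 1"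
    using assms by (auto simp: Gamma_cc_def)
  have orb: "j = k" if "h \<in> G2" "h j = k" for h
    using G2_sorted_unique[OF that(1), of j] jk that(2) by simp
  have "- sigma3 \<in> G2" "- sigma1 \<in> G2"
    by (simp_all add: G2_elements)
  then have g': "- sigma3 \<circ> g \<in> G2" "- sigma1 \<circ> g \<in> G2"
    using assms(4) by (simp_all only: G2_comp)
  have "g j = k \<or> g j = vector [k $ 3, k $ 2, k $ 1] \<or> g j = vector [k $ 1, k $ 3, k $ 2]"
    using Gamma_cc_veccong_cases[OF assms(1,3) _ _ assms(5)] G2_Hdag[OF assms(4) jk(1)]
      G2_Gamma_diff_le[OF assms(4,2)] by blast
  then have "g j = k \<or> (- sigma3 \<circ> g) j = k \<or> (- sigma1 \<circ> g) j = k"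
    by (auto simp: vec3_eq_iff)
  then show ?thesis
    using orb assms(4) g' by blast
qed

text \<open>For \<open>k\<close> in \<open>Gamma_cc n\<close> this is the reciprocal of the number
  of points of its orbit that are congruent to \<open>k\<close>: one off the wall
  \<open>k1 - k3 = n\<close>, two on it, three at its end \<open>(n/3, n/3, -2n/3)\<close>.\<close>

definition wall_weight :: "nat \<Rightarrow> int ^ 3 \<Rightarrow> real" where
  "wall_weight n k = (if k $ 1 - k $ 3 < int n then 1 else if k $ 1 = k $ 2 then 1 / 3 else 1 / 2)"

text \<open>The stabilizer modulo \<open>n\<close> is a disjoint union of equally large sets, one
  for each orbit point congruent to \<open>k\<close>; the set \<open>V\<close> of the proof lists
  these points.\<close>

lemma card_veccong_stabilizer:
  assumes "n \<ge> 1" "k \<in> Gamma_cc n"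
  shows "wall_weight n k * real (card {g \<in> G2. veccong n (g k) k}) = real (card {g \<in> G2. g k = k})"
proof -
  define a b where "a = (vector [k $ 3, k $ 2, k $ 1] :: int ^ 3)"
    and "b = (vector [k $ 1, k $ 3, k $ 2] :: int ^ 3)"
  define V where "V = {k} \<union> (if k $ 1 - k $ 3 = int n then {a} else {})
    \<union> (if k $ 2 - k $ 3 = int n then {b} else {})"
  have k: "k \<in> Hdag" "k $ 1 + k $ 2 + k $ 3 = 0" "0 \<le> k $ 2" "k $ 2 \<le> k $ 1" "k $ 1 \<le> k $ 3 + int n"
    using assms(2) by (auto simp: Gamma_cc_def Hdag_def)
  have V: "veccong n (g k) k \<longleftrightarrow> g k \<in> V" if "g \<in> G2" for g
  proof
    show "veccong n (g k) k \<Longrightarrow> g k \<in> V"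
      using Gamma_cc_veccong_cases[OF assms G2_Hdag[OF that k(1)] G2_Gamma_diff_le[OF that assms(2)]]
      by (auto simp: V_def a_def b_def)
    have "veccong n a k" if "k $ 1 - k $ 3 = int n"
      using that by (auto simp: veccong_def a_def forall_3 minus_dvd_iff dvd_diff_commute)
    moreover have "veccong n b k" if "k $ 2 - k $ 3 = int n"
      using that by (auto simp: veccong_def b_def forall_3 dvd_diff_commute)
    ultimately show "g k \<in> V \<Longrightarrow> veccong n (g k) k"
      by (auto simp: V_def split: if_splits)
  qed
  have "id k = k" "(- sigma3) k = a" "(- sigma1) k = b"
    by (simp_all add: a_def b_def vec3_eq_iff)
  then have orbit: "k \<in> G2_orbit k" "a \<in> G2_orbit k" "b \<in> G2_orbit k"
    unfolding mem_G2_orbit by (force simp: G2_elements)+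
  have finite_V: "finite V"
    by (simp add: V_def)
  have "{g \<in> G2. veccong n (g k) k} = (\<Union>y\<in>V. {g \<in> G2. g k = y})"
    using V by auto
  then have "card {g \<in> G2. veccong n (g k) k} = (\<Sum>y\<in>V. card {g \<in> G2. g k = y})"
    using finite_V by (simp only:) (rule card_UN_disjoint; auto)
  also have "\<dots> = (\<Sum>y\<in>V. card {g \<in> G2. g k = k})"
    using orbit by (intro sum.cong refl card_G2_transporter) (auto simp: V_def split: if_splits)
  also have "\<dots> = card V * card {g \<in> G2. g k = k}"
    by simp
  finally have 1: "card {g \<in> G2. veccong n (g k) k} = card V * card {g \<in> G2. g k = k}" .
  have "wall_weight n k * real (card V) = 1"
    using k assms(1) unfolding V_def wall_weight_def
    by (auto simp: a_def b_def vec3_eq_iff card_insert_if)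
  then show ?thesis
    by (simp add: 1)
qed

lemma card_veccong_stabilizer_weight:
  assumes "n \<ge> 1" "k \<in> Gamma_cc n"
  shows "wall_weight n k * real (card (G2_orbit k)) * real (card {g \<in> G2. veccong n (g k) k}) = 12"
proof -
  have "wall_weight n k * real (card (G2_orbit k)) * real (card {g \<in> G2. veccong n (g k) k})
      = real (card (G2_orbit k) * card {g \<in> G2. g k = k})"
    using card_veccong_stabilizer[OF assms] by (simp add: mult_ac)
  then show ?thesis
    by (simp add: card_G2_orbit)
qed

section \<open>The change of coordinates from frequencies to nodes\<close>

definition rot :: "int ^ 3 \<Rightarrow> int ^ 3" where
  "rot k = sigma1 (hat k)"

lemma hat_nth [simp]: "hat k $ 1 = k $ 3 - k $ 2" "hat k $ 2 = k $ 1 - k $ 3" "hat k $ 3 = k $ 2 - k $ 1"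
  by (simp_all add: hat_def)

lemma rot_nth [simp]: "rot k $ 1 = k $ 2 - k $ 3" "rot k $ 2 = k $ 1 - k $ 2" "rot k $ 3 = k $ 3 - k $ 1"
  by (simp_all add: rot_def)

lemma inj_on_hat: "inj_on hat Hdag"
  by (auto simp: inj_on_def Hdag_def vec3_eq_iff)

text \<open>\<open>hat k\<close> is the cross product of \<open>(1, 1, 1)\<close> with
  \<open>k\<close>, so \<open>hat\<close> commutes with a signed permutation up to the sign of the
  permutation, and \<open>G2\<close> is closed under negation.\<close>

lemma hat_G2:
  assumes "g \<in> G2"
  shows "\<exists>h\<in>G2. \<forall>k. hat (g k) = h (hat k)" "\<exists>h\<in>G2. \<forall>k. hat (h k) = g (hat k)"
proof -
  have pm: "(\<forall>k. hat (g k) = g (hat k)) \<or> (\<forall>k. hat (g k) = - g (hat k))"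
    using assms unfolding G2_elements by (elim insertE emptyE) (simp_all add: vec3_eq_iff)
  have neg: "hat (- x) = - hat x" for x
    by (simp add: vec3_eq_iff)
  have "- g \<in> G2"
    using assms by (auto simp: G2_elements)
  with pm assms show "\<exists>h\<in>G2. \<forall>k. hat (g k) = h (hat k)" "\<exists>h\<in>G2. \<forall>k. hat (h k) = g (hat k)"
    by (auto intro: bexI[of _ g] bexI[of _ "- g"] simp: neg)
qed

lemma G2_orbit_hat: "G2_orbit (hat k) = hat ` G2_orbit k"
proof
  show "G2_orbit (hat k) \<subseteq> hat ` G2_orbit k"
    using hat_G2(2)[THEN bexE] by (auto simp: G2_orbit_eq_image) (metis image_eqI)
  show "hat ` G2_orbit k \<subseteq> G2_orbit (hat k)"
    using hat_G2(1) by (fastforce simp: mem_G2_orbit)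
qed

lemma card_G2_orbit_hat:
  assumes "k \<in> Hdag"
  shows "card (G2_orbit (hat k)) = card (G2_orbit k)"
  unfolding G2_orbit_hat
proof (intro card_image inj_on_subset[OF inj_on_hat])
  show "G2_orbit k \<subseteq> Hdag"
    using assms by (auto simp: mem_G2_orbit G2_Hdag)
qed

lemma card_G2_orbit_rot:
  assumes "k \<in> Hdag"
  shows "card (G2_orbit (rot k)) = card (G2_orbit k)"
proof -
  have "sigma1 \<in> G2"
    by (simp add: G2_elements)
  then show ?thesis
    using assms by (simp add: rot_def G2_orbit_apply card_G2_orbit_hat)
qed

lemma permuted_vec3:
  fixes x :: "int ^ 3"
  shows "(\<exists>p. p permutes (UNIV :: 3 set) \<and> x = (\<chi> i. vector [a, b, c] $ p i)) \<longleftrightarrow>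
    (x $ 1, x $ 2, x $ 3) \<in> {(a,b,c), (a,c,b), (b,a,c), (b,c,a), (c,a,b), (c,b,a)}" (is "?L \<longleftrightarrow> ?R")
proof
  assume ?L
  then obtain p where p: "p permutes (UNIV :: 3 set)" "x = (\<chi> i. vector [a, b, c] $ p i)"
    by blast
  from p(1) show ?R
    unfolding p(2) permutes_3 by (elim insertE emptyE) simp_all
next
  have perm: "\<exists>p. p permutes (UNIV :: 3 set) \<and> x = (\<chi> i. vector [a, b, c] $ p i)"
    if "(u, v, w) \<in> {(1,2,3), (1,3,2), (2,1,3), (2,3,1), (3,1,2), (3,2,1)}"
      "x $ 1 = (vector [a, b, c] :: int ^ 3) $ u" "x $ 2 = (vector [a, b, c] :: int ^ 3) $ v"
      "x $ 3 = (vector [a, b, c] :: int ^ 3) $ w" for u v w :: 3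
    using that by (intro exI[of _ "\<lambda>i. if i = 1 then u else if i = 2 then v else w"])
      (simp add: permutes_3 vec3_eq_iff)
  assume ?R
  then show ?L
    using perm[of 1 2 3] perm[of 1 3 2] perm[of 2 1 3] perm[of 2 3 1] perm[of 3 1 2] perm[of 3 2 1]
    by (elim insertE emptyE) simp_all
qed

text \<open>Up to sign, the coordinates of \<open>hat k\<close> and \<open>rot k\<close> are the
  differences of those of \<open>k\<close>, the largest being \<open>k1 - k3\<close>. When it equals
  \<open>n\<close>, another difference can vanish only through \<open>k1 = k2\<close>, since
  \<open>k2 = k3\<close> would force \<open>k = 0\<close>.\<close>

lemma c_weight_hat_rot:
  assumes "n \<ge> 1" "k \<in> Gamma_cc n"
  shows "c_weight n (hat k) = wall_weight n k" "c_weight n (rot k) = wall_weight n k"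
  using assms unfolding c_weight_def permuted_vec3 wall_weight_def Gamma_cc_def Hdag_def
  by (auto simp: forall_3)

lemma omega_hat_rot:
  assumes "n \<ge> 1" "k \<in> Gamma_cc n"
  shows "omega n (hat k) = wall_weight n k * real (card (G2_orbit k))" "omega n (rot k) = wall_weight n k * real (card (G2_orbit k))"
proof -
  have "k \<in> Hdag"
    using assms(2) by (simp add: Gamma_cc_def)
  then show "omega n (hat k) = wall_weight n k * real (card (G2_orbit k))" "omega n (rot k) = wall_weight n k * real (card (G2_orbit k))"
    using assms by (simp_all add: omega_def c_weight_hat_rot card_G2_orbit_hat card_G2_orbit_rot)
qed

lemma bij_betw_rot: "bij_betw rot (Gamma_cc n) (Upsilon n)"
proof (rule bij_betw_byWitness)
  \<comment> \<open>On \<open>Hdag\<close>, applying \<open>rot\<close> twice is multiplication by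
    3, so the inverse is \<open>rot\<close> followed by division by 3. The division is exact on
    \<open>Hlat\<close> by the congruences.\<close>
  define r where "r j = (vector [(j $ 2 - j $ 3) div 3, (j $ 1 - j $ 2) div 3, (j $ 3 - j $ 1) div 3] :: int ^ 3)" for j :: "int ^ 3"
  show "\<forall>k\<in>Gamma_cc n. r (rot k) = k"
  proof
    fix k assume "k \<in> Gamma_cc n"
    then have "k $ 3 = - k $ 1 - k $ 2"
      by (auto simp: Gamma_cc_def Hdag_def)
    then show "r (rot k) = k"
      by (simp add: r_def vec3_eq_iff)
  qed
  have ex: "\<exists>a b. j $ 1 - j $ 2 = 3 * a \<and> j $ 2 - j $ 3 = 3 * b" if "j \<in> Upsilon n" for j
    using that by (simp add: Upsilon_def Hlat_def cong_iff_dvd_diff dvd_def)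
  show "\<forall>j\<in>Upsilon n. rot (r j) = j"
  proof
    fix j assume j: "j \<in> Upsilon n"
    obtain a b where ab: "j $ 1 - j $ 2 = 3 * a" "j $ 2 - j $ 3 = 3 * b"
      using ex[OF j] by blast
    have "j $ 3 - j $ 1 = 3 * (- a - b)" and sum: "j $ 1 + j $ 2 + j $ 3 = 0"
      using ab j by (simp_all add: Upsilon_def Hlat_def Hdag_def)
    then have "(j $ 3 - j $ 1) div 3 = - a - b"
      by (simp only:) simp
    with ab sum show "rot (r j) = j"
      by (simp add: r_def vec3_eq_iff)
  qed
  show "rot ` Gamma_cc n \<subseteq> Upsilon n"
    by (auto simp: Gamma_cc_def Upsilon_def Hlat_def Hdag_def cong_iff_dvd_diff; presburger)
  show "r ` Upsilon n \<subseteq> Gamma_cc n"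
  proof
    fix x assume "x \<in> r ` Upsilon n"
    then obtain j where j: "j \<in> Upsilon n" "x = r j"
      by blast
    obtain a b where ab: "j $ 1 - j $ 2 = 3 * a" "j $ 2 - j $ 3 = 3 * b"
      using ex[OF j(1)] by blast
    have c: "j $ 3 - j $ 1 = 3 * (- a - b)"
      using ab by simp
    then have "(j $ 3 - j $ 1) div 3 = - a - b"
      by (simp only:) simp
    with ab have "r j = vector [b, a, - a - b]"
      by (simp add: r_def)
    with ab j show "x \<in> Gamma_cc n"
      by (auto simp: Gamma_cc_def Upsilon_def Hlat_def Hdag_def)
  qed
qed

lemma finite_Gamma_cc: "finite (Gamma_cc n)"
  using bij_betw_finite[OF bij_betw_rot] finite_Upsilon by blast

text \<open>Representatives of \<open>Hdag / n Hdag\<close>. Only the first two coordinates are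
  reduced; the third is left unreduced to keep the sum zero.\<close>

definition residues_Hdag :: "nat \<Rightarrow> (int ^ 3) set" where
  "residues_Hdag n = (\<lambda>(a, b). vector [a, b, - a - b]) ` ({0..<int n} \<times> {0..<int n})"

lemma residues_Hdag_in_Hdag: "x \<in> residues_Hdag n \<Longrightarrow> x \<in> Hdag"
  by (auto simp: residues_Hdag_def Hdag_def)

lemma finite_residues_Hdag: "finite (residues_Hdag n)"
  by (simp add: residues_Hdag_def)

lemma residues_Hdag_unique:
  assumes "n \<ge> 1" "x \<in> Hdag"
  shows "\<exists>!r. r \<in> residues_Hdag n \<and> veccong n x r"
proof -
  define r where "r = (vector [x $ 1 mod n, x $ 2 mod n, - (x $ 1 mod n) - x $ 2 mod n] :: int ^ 3)"
  have x3: "x $ 3 = - x $ 1 - x $ 2"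
    using assms(2) by (simp add: Hdag_def)
  have "r \<in> residues_Hdag n"
    using assms(1) by (auto simp: residues_Hdag_def r_def)
  moreover have "veccong n x r"
  proof -
    have 1: "int n dvd x $ 1 - x $ 1 mod n" "int n dvd x $ 2 - x $ 2 mod n"
      by (simp_all add: minus_mod_eq_mult_div)
    then have "int n dvd - ((x $ 1 - x $ 1 mod n) + (x $ 2 - x $ 2 mod n))"
      by (subst dvd_minus_iff) (rule dvd_add)
    with 1 show ?thesis
      by (simp add: veccong_def forall_3 r_def x3 algebra_simps)
  qed
  moreover have "r' = r" if r': "r' \<in> residues_Hdag n" "veccong n x r'" for r'
  proof -
    obtain a b where ab: "r' = vector [a, b, - a - b]" "0 \<le> a" "a < n" "0 \<le> b" "b < n"
      using r'(1) by (auto simp: residues_Hdag_def)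
    have "int n dvd x $ 1 - a" "int n dvd x $ 2 - b"
      using r'(2) by (auto simp: veccong_def forall_3 ab(1))
    then have "x $ 1 mod n = a mod n" "x $ 2 mod n = b mod n"
      by (simp_all add: mod_eq_dvd_iff)
    then show ?thesis
      using ab by (simp add: r_def)
  qed
  ultimately show ?thesis
    by blast
qed

text \<open>Counting the triples \<open>(g, k, r)\<close> with \<open>g k \<equiv> r\<close> in two ways folds a sum over residue classes
  into a weighted sum over the fundamental domain.\<close>

lemma sum_Upsilon_fold:
  fixes F :: "int ^ 3 \<Rightarrow> complex"
  assumes n: "n \<ge> 1"
    and inv: "\<And>g x. g \<in> G2 \<Longrightarrow> x \<in> Hdag \<Longrightarrow> F (g x) = F x"
    and per: "\<And>x y. x \<in> Hdag \<Longrightarrow> y \<in> Hdag \<Longrightarrow> veccong n x y \<Longrightarrow> F x = F y"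
  shows "(\<Sum>k\<in>Gamma_cc n. of_real (omega n (rot k)) * F k) = (\<Sum>r\<in>residues_Hdag n. F r)"
proof -
  define N where "N k r = card {g \<in> G2. veccong n (g k) r}" for k r
  define w where "w k = omega n (rot k)" for k
  have w: "w k * real (N k k) = 12" if "k \<in> Gamma_cc n" for k
    using card_veccong_stabilizer_weight[OF n that] by (simp add: w_def omega_hat_rot[OF n that] N_def)
  have Hdag: "k \<in> Hdag" if "k \<in> Gamma_cc n" for k
    using that by (simp add: Gamma_cc_def)
  \<comment> \<open>Once some \<open>h\<close> carries \<open>k\<close> to \<open>r\<close> modulo
    \<open>n\<close>, all such maps form a coset of the stabilizer of \<open>k\<close> modulo
    \<open>n\<close>.\<close>
  have N_eq: "N k r = N k k" if h: "h \<in> G2" "veccong n (h k) r" for k r h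
  proof -
    have "{g \<in> G2. veccong n (g k) r} = {g \<in> G2. veccong n (g k) (h k)}"
      using h(2) by (auto intro: veccong_trans veccong_sym)
    also have "\<dots> = (\<lambda>g. h \<circ> g) ` {g \<in> G2. veccong n (g k) k}"
    proof -
      have "G2 = (\<lambda>g. h \<circ> g) ` G2"
        using G2_comp_bij(1)[OF h(1)] by (simp add: bij_betw_def)
      then have "{g \<in> G2. veccong n (g k) (h k)} = {g \<in> (\<lambda>g. h \<circ> g) ` G2. veccong n (g k) (h k)}"
        by simp
      also have "\<dots> = (\<lambda>g. h \<circ> g) ` {g \<in> G2. veccong n (g k) k}"
        using veccong_G2_iff[OF h(1)] by auto
      finally show ?thesis .
    qed
    also have "card \<dots> = N k k"
      unfolding N_def using G2_comp_bij(1)[OF h(1)]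
      by (intro card_image) (auto simp: bij_betw_def inj_on_def)
    finally show ?thesis
      by (simp add: N_def)
  qed
  have N_sum: "(\<Sum>r\<in>residues_Hdag n. N k r) = 12" if k: "k \<in> Gamma_cc n" for k
  proof -
    have "G2 = (\<Union>r\<in>residues_Hdag n. {g \<in> G2. veccong n (g k) r})"
      using residues_Hdag_unique[OF n G2_Hdag[OF _ Hdag[OF k]]] by blast
    then have "12 = card (\<Union>r\<in>residues_Hdag n. {g \<in> G2. veccong n (g k) r})"
      by (simp add: card_G2)
    also have "\<dots> = (\<Sum>r\<in>residues_Hdag n. N k r)"
      unfolding N_def
      using residues_Hdag_unique[OF n G2_Hdag[OF _ Hdag[OF k]]]
      by (intro card_UN_disjoint) (auto simp: finite_residues_Hdag)
    finally show ?thesis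
      by simp
  qed
  \<comment> \<open>Exactly one \<open>k\<close> of the domain is equivalent to \<open>r\<close>,
    and for it \<open>N k r\<close> is the order of the stabilizer modulo \<open>n\<close>, whose
    product with the weight is 12.\<close>
  have fibre: "(\<Sum>k\<in>Gamma_cc n. of_real (w k) * (of_nat (N k r) :: complex)) = 12" if r: "r \<in> residues_Hdag n" for r
  proof -
    obtain g k where gk: "g \<in> G2" "k \<in> Gamma_cc n" "veccong n (g r) k"
      using Gamma_cc_representative[OF n residues_Hdag_in_Hdag[OF r]] .
    obtain h where h: "h \<in> G2" "h \<circ> g = id" 
      using G2_inverse[OF gk(1)] .
    have "veccong n (h k) (h (g r))"
      using gk(3) h(1) by (simp add: veccong_G2_iff veccong_sym)
    moreover have "h (g r) = r"
      using h(2) by (auto simp: fun_eq_iff)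
    ultimately have hk: "veccong n (h k) r"
      by simp
    have "N j r = 0" if j: "j \<in> Gamma_cc n" "j \<noteq> k" for j
    proof -
      have "\<not> veccong n (f j) r" if f: "f \<in> G2" for f
      proof
        assume "veccong n (f j) r"
        then have "veccong n ((g \<circ> f) j) k"
          using veccong_trans[OF veccong_G2[OF gk(1)] gk(3)] by simp
        then show False
          using Gamma_cc_veccong_unique[OF n j(1) gk(2) G2_comp[OF gk(1) f]] j(2) by blast
      qed
      then show ?thesis
        by (simp add: N_def)
    qed
    then have "(\<Sum>k\<in>Gamma_cc n. of_real (w k) * (of_nat (N k r) :: complex)) = of_real (w k) * of_nat (N k r)"
      using gk(2) by (subst sum.remove[OF finite_Gamma_cc gk(2)]) simp
    also have "\<dots> = of_real (w k * real (N k k))"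
      by (simp add: N_eq[OF h(1) hk])
    finally show ?thesis
      by (simp add: w[OF gk(2)])
  qed
  have NF: "of_nat (N k r) * F k = of_nat (N k r) * F r" if "k \<in> Gamma_cc n" "r \<in> residues_Hdag n" for k r
  proof (cases "N k r = 0")
    case False
    then have "{g \<in> G2. veccong n (g k) r} \<noteq> {}"
      unfolding N_def by (metis card.empty)
    then obtain g where g: "g \<in> G2" "veccong n (g k) r"
      by blast
    have "F (g k) = F r"
      by (rule per[OF G2_Hdag[OF g(1) Hdag[OF that(1)]] residues_Hdag_in_Hdag[OF that(2)] g(2)])
    then show ?thesis
      using inv[OF g(1) Hdag[OF that(1)]] by simp
  qed simp
  \<comment> \<open>The factor 12 is written as the row sum \<open>N_sum\<close>, \<open>F k\<close>
    is exchanged for \<open>F r\<close> by \<open>NF\<close>, and after swapping the sums the column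
    sum \<open>fibre\<close> returns the 12.\<close>
  have "12 * (\<Sum>k\<in>Gamma_cc n. of_real (w k) * F k)
      = (\<Sum>k\<in>Gamma_cc n. \<Sum>r\<in>residues_Hdag n. of_real (w k) * (of_nat (N k r) * F k))"
    unfolding sum_distrib_left
  proof (intro sum.cong refl)
    fix k assume k: "k \<in> Gamma_cc n"
    have "(12 :: complex) = of_nat (\<Sum>r\<in>residues_Hdag n. N k r)"
      by (simp add: N_sum[OF k])
    then have "12 * (of_real (w k) * F k) = (\<Sum>r\<in>residues_Hdag n. of_nat (N k r)) * (of_real (w k) * F k)"
      by simp
    also have "\<dots> = (\<Sum>r\<in>residues_Hdag n. of_real (w k) * (of_nat (N k r) * F k))"
      unfolding sum_distrib_right by (simp add: mult_ac)
    finally show "12 * (of_real (w k) * F k) = (\<Sum>r\<in>residues_Hdag n. of_real (w k) * (of_nat (N k r) * F k))" .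
  qed
  also have "\<dots> = (\<Sum>k\<in>Gamma_cc n. \<Sum>r\<in>residues_Hdag n. of_real (w k) * of_nat (N k r) * F r)"
    unfolding mult.assoc by (rule sum.cong[OF refl], rule sum.cong[OF refl], subst NF) auto
  also have "\<dots> = (\<Sum>r\<in>residues_Hdag n. (\<Sum>k\<in>Gamma_cc n. of_real (w k) * of_nat (N k r)) * F r)"
    by (subst sum.swap) (simp add: sum_distrib_right)
  also have "\<dots> = 12 * (\<Sum>r\<in>residues_Hdag n. F r)"
    by (simp add: fibre sum_distrib_left)
  finally show ?thesis
    by (simp add: w_def)
qed


section \<open>Discrete orthogonality\<close>

definition echar :: "nat \<Rightarrow> int \<Rightarrow> complex" where
  "echar n a = cis (2 * pi * of_int a / of_nat n)"

lemma echar_0 [simp]: "echar n 0 = 1"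
  by (simp add: echar_def)

lemma echar_add: "echar n (a + b) = echar n a * echar n b"
  by (simp add: echar_def cis_mult add_divide_distrib distrib_left)

lemma cnj_echar: "cnj (echar n a) = echar n (- a)"
  by (simp add: echar_def cis_cnj)

lemma echar_eq_1_iff:
  assumes "n \<ge> 1"
  shows "echar n a = 1 \<longleftrightarrow> int n dvd a"
proof
  assume "echar n a = 1"
  then have "cos (2 * pi * of_int a / of_nat n) = 1"
    by (simp add: echar_def complex_eq_iff)
  then obtain m :: int where "2 * pi * of_int a / of_nat n = of_int m * 2 * pi"
    unfolding cos_one_2pi_int by blast
  then have "real_of_int a = real_of_int (int n * m)"
    using assms by (simp add: field_simps)
  then show "int n dvd a"
    unfolding of_int_eq_iff by simp
next
  assume "int n dvd a"
  then obtain m where "a = int n * m"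
    by (auto simp: dvd_def)
  then have "2 * pi * of_int a / of_nat n = 2 * pi * of_int m"
    using assms by simp
  then show "echar n a = 1"
    by (simp only: echar_def cis_multiple_2pi Ints_of_int)
qed

lemma echar_mult_nat: "echar n (a * int m) = echar n a ^ m"
  by (induction m) (simp_all add: echar_add algebra_simps)

lemma sum_echar:
  assumes "n \<ge> 1"
  shows "(\<Sum>m\<in>{0..<int n}. echar n (a * m)) = (if int n dvd a then of_nat n else 0)"
proof -
  have "(\<Sum>m\<in>{0..<int n}. echar n (a * m)) = (\<Sum>m<n. echar n a ^ m)"
    by (rule sum.reindex_bij_witness[of _ int nat]) (auto simp: echar_mult_nat[symmetric])
  also have "\<dots> = (if int n dvd a then of_nat n else 0)"
  proof (cases "int n dvd a")
    case True
    then show ?thesis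
      using echar_eq_1_iff[OF assms, of a] by simp
  next
    case False
    have "echar n a ^ n = 1"
      unfolding echar_mult_nat[symmetric] using echar_eq_1_iff[OF assms] by simp
    then show ?thesis
      using False echar_eq_1_iff[OF assms, of a] by (simp add: geometric_sum)
  qed
  finally show ?thesis .
qed

text \<open>For \<open>k\<close> and \<open>m\<close> in \<open>Hdag\<close> this is a third of the
  dot product of \<open>k\<close> with \<open>rot m\<close>; the factor 3 cancels the denominator in
  \<open>phi\<close>.\<close>

definition bform :: "int ^ 3 \<Rightarrow> int ^ 3 \<Rightarrow> int" where
  "bform k m = k $ 1 * m $ 1 + k $ 1 * m $ 2 + k $ 2 * m $ 1"

lemma bform_diff: "bform (k - l) m = bform k m - bform l m" "bform k (l - m) = bform k l - bform k m"
  by (simp_all add: bform_def algebra_simps)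

lemma phi_node_rot:
  assumes "n \<ge> 1" "k \<in> Hdag" "m \<in> Hdag"
  shows "phi k (node n (rot m)) = echar n (bform k m)"
proof -
  have k: "real_of_int (k $ 3) = - real_of_int (k $ 1) - real_of_int (k $ 2)"
    and m: "real_of_int (m $ 3) = - real_of_int (m $ 1) - real_of_int (m $ 2)"
    using assms(2,3) by (simp_all add: Hdag_def flip: of_int_minus of_int_diff)
  have "rvec k \<bullet> node n (rot m) = (real_of_int (k $ 1) * (rot m $ 1) + k $ 2 * rot m $ 2 + k $ 3 * rot m $ 3) / n"
    using assms(1) by (simp add: node_def rvec_def inner_vec_def sum_3 field_simps)
  also have "\<dots> = 3 * of_int (bform k m) / n"
    by (simp add: k m bform_def algebra_simps)
  finally show ?thesis
    by (simp add: phi_def echar_def cis_conv_exp mult_ac)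
qed

text \<open>At \<open>r = (a, b, -a - b)\<close> the exponent is \<open>(x1 + x2) a + x1 b\<close>,
  so the sum factors into two geometric sums.\<close>

lemma sum_residues_echar:
  assumes "n \<ge> 1" "x \<in> Hdag"
  shows "(\<Sum>r\<in>residues_Hdag n. echar n (bform x r)) = of_nat n ^ 2 * of_bool (veccong n x 0)"
proof -
  have x3: "x $ 3 = - x $ 1 - x $ 2"
    using assms(2) by (simp add: Hdag_def)
  have "(\<Sum>r\<in>residues_Hdag n. echar n (bform x r))
      = (\<Sum>(a, b)\<in>{0..<int n} \<times> {0..<int n}. echar n (bform x (vector [a, b, - a - b])))"
    unfolding residues_Hdag_def by (subst sum.reindex) (auto simp: inj_on_def vec3_eq_iff case_prod_unfold)
  also have "\<dots> = (\<Sum>(a, b)\<in>{0..<int n} \<times> {0..<int n}. echar n ((x $ 1 + x $ 2) * a) * echar n (x $ 1 * b))"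
    by (intro sum.cong refl) (auto simp: bform_def echar_add[symmetric] algebra_simps)
  also have "\<dots> = (\<Sum>a\<in>{0..<int n}. echar n ((x $ 1 + x $ 2) * a)) * (\<Sum>b\<in>{0..<int n}. echar n (x $ 1 * b))"
    by (simp add: sum_product sum.cartesian_product)
  also have "\<dots> = of_nat n ^ 2 * of_bool (int n dvd x $ 1 + x $ 2 \<and> int n dvd x $ 1)"
    by (simp add: sum_echar[OF assms(1)] power2_eq_square)
  also have "int n dvd x $ 1 + x $ 2 \<and> int n dvd x $ 1 \<longleftrightarrow> veccong n x 0"
  proof -
    have "- x $ 1 - x $ 2 = - (x $ 1 + x $ 2)"
      by simp
    then show ?thesis
      by (simp only: veccong_def forall_3 x3 zero_index diff_zero dvd_minus_iff) (auto simp: dvd_add_right_iff)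
  qed
  finally show ?thesis .
qed

lemma veccong_iff_diff: "veccong n x y \<longleftrightarrow> veccong n (x - y) 0"
  by (simp add: veccong_def)

lemma echar_bform_cong:
  assumes "n \<ge> 1" "veccong n x y"
  shows "echar n (bform k x) = echar n (bform k y)"
proof -
  have "int n dvd bform k (x - y)"
    using assms(2) unfolding bform_def veccong_def by simp
  then have "echar n (bform k x - bform k y) = 1"
    using echar_eq_1_iff[OF assms(1)] by (simp add: bform_diff)
  then show ?thesis
    using echar_add[of n "bform k x - bform k y" "bform k y"] by simp
qed

text \<open>Each map has an adjoint within the group. For the dot product it would be the inverse;
  the \<open>rot\<close> inside \<open>bform\<close> conjugates this by \<open>sigma1\<close> and
  multiplies it by the sign of the permutation, which gives the table in the proof.\<close>

lemma bform_G2: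
  assumes "g \<in> G2"
  shows "\<exists>h\<in>G2. \<forall>k\<in>Hdag. \<forall>m\<in>Hdag. bform k (g m) = bform (h k) m"
proof -
  define P where "P g h \<longleftrightarrow> (\<forall>k\<in>Hdag. \<forall>m\<in>Hdag. bform k (g m) = bform (h k) m)" for g h :: "int ^ 3 \<Rightarrow> int ^ 3"
  have 3: "k $ 3 = - k $ 1 - k $ 2" if "k \<in> Hdag" for k
    using that by (simp add: Hdag_def)
  have "P id id" "P sigma1 (- sigma1)" "P sigma2 (- sigma3)" "P sigma3 (- sigma2)"
    "P (sigma2 \<circ> sigma1) (sigma2 \<circ> sigma1)" "P (sigma1 \<circ> sigma2) (sigma1 \<circ> sigma2)"
    "P (- id) (- id)" "P (- sigma1) sigma1" "P (- sigma2) sigma3" "P (- sigma3) sigma2"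
    "P (- (sigma2 \<circ> sigma1)) (- (sigma2 \<circ> sigma1))" "P (- (sigma1 \<circ> sigma2)) (- (sigma1 \<circ> sigma2))"
    unfolding P_def by (simp_all add: bform_def 3 algebra_simps)
  with assms have "\<exists>h\<in>G2. P g h"
    unfolding G2_elements by (elim insertE emptyE; hypsubst) blast+
  then show ?thesis
    unfolding P_def .
qed

section \<open>The sign characters behind the four families\<close>

definition G2_char :: "((int ^ 3 \<Rightarrow> int ^ 3) \<Rightarrow> complex) \<Rightarrow> bool" where
  "G2_char \<xi> \<longleftrightarrow> (\<forall>g\<in>G2. \<xi> g = 1 \<or> \<xi> g = - 1) \<and> (\<forall>g\<in>G2. \<forall>h\<in>G2. \<xi> (g \<circ> h) = \<xi> g * \<xi> h)"

text \<open>\<open>1\<close> is the all-ones vector, fixed by every permutation, so its image shows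
  the global sign of \<open>g\<close>.\<close>

definition chi_cs :: "(int ^ 3 \<Rightarrow> int ^ 3) \<Rightarrow> complex" where
  "chi_cs g = of_int (g 1 $ 1)"

definition vandermonde3 :: "int ^ 3 \<Rightarrow> int" where
  "vandermonde3 x = (x $ 1 - x $ 2) * (x $ 2 - x $ 3) * (x $ 3 - x $ 1)"

text \<open>The Vandermonde product is multiplied by the sign of a permutation under permutations and
  by \<open>-1\<close> under negation; its value at \<open>(0, 1, 2)\<close> is \<open>2\<close>.\<close>

definition chi_sc :: "(int ^ 3 \<Rightarrow> int ^ 3) \<Rightarrow> complex" where
  "chi_sc g = of_int (vandermonde3 (g (vector [0, 1, 2])) div 2)"

text \<open>The global signs cancel, leaving the sign of the permutation.\<close>

definition chi_ss :: "(int ^ 3 \<Rightarrow> int ^ 3) \<Rightarrow> complex" where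
  "chi_ss g = chi_cs g * chi_sc g"

lemma G2_char_1: "G2_char (\<lambda>_. 1)"
  by (simp add: G2_char_def)

lemma G2_char_cs: "G2_char chi_cs"
  unfolding G2_char_def
proof (intro conjI ballI)
  fix g assume "g \<in> G2"
  then show "chi_cs g = 1 \<or> chi_cs g = - 1"
    unfolding G2_elements by (elim insertE emptyE) (simp_all add: chi_cs_def)
next
  fix g h assume "g \<in> G2" "h \<in> G2"
  then obtain s p t q where "g = (\<lambda>x. \<chi> i. s * x $ p i)" "h = (\<lambda>x. \<chi> i. t * x $ q i)"
    unfolding G2_iff by blast
  then show "chi_cs (g \<circ> h) = chi_cs g * chi_cs h"
    by (simp add: chi_cs_def)
qed

lemma G2_char_sc: "G2_char chi_sc"
  unfolding G2_char_def
proof (intro conjI ballI)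
  fix g assume "g \<in> G2"
  then show "chi_sc g = 1 \<or> chi_sc g = - 1"
    unfolding G2_elements by (elim insertE emptyE) (simp_all add: chi_sc_def vandermonde3_def)
next
  \<comment> \<open>Each \<open>g\<close> scales the Vandermonde product of every vector by the
    factor read off at \<open>(0, 1, 2)\<close>; multiplicativity follows.\<close>
  have *: "of_int (vandermonde3 (g x)) = chi_sc g * of_int (vandermonde3 x)" if "g \<in> G2" for g x
    using that unfolding G2_elements by (elim insertE emptyE)
      (simp_all add: chi_sc_def vandermonde3_def algebra_simps)
  fix g h assume gh: "g \<in> G2" "h \<in> G2"
  have "vandermonde3 (vector [0, 1, 2]) = 2"
    by (simp add: vandermonde3_def)
  then show "chi_sc (g \<circ> h) = chi_sc g * chi_sc h"
    using *[of "g \<circ> h" "vector [0, 1, 2]"] *[of g "h (vector [0, 1, 2])"] *[of h "vector [0, 1, 2]"]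
      gh G2_comp[OF gh] by simp
qed

lemma G2_char_ss: "G2_char chi_ss"
  unfolding G2_char_def
proof (intro conjI ballI)
  fix g assume "g \<in> G2"
  then have "chi_cs g = 1 \<or> chi_cs g = - 1" "chi_sc g = 1 \<or> chi_sc g = - 1"
    using G2_char_cs G2_char_sc by (simp_all add: G2_char_def)
  then show "chi_ss g = 1 \<or> chi_ss g = - 1"
    by (auto simp: chi_ss_def)
next
  fix g h assume "g \<in> G2" "h \<in> G2"
  then have "chi_cs (g \<circ> h) = chi_cs g * chi_cs h" "chi_sc (g \<circ> h) = chi_sc g * chi_sc h"
    using G2_char_cs G2_char_sc by (simp_all add: G2_char_def)
  then show "chi_ss (g \<circ> h) = chi_ss g * chi_ss h"
    by (simp add: chi_ss_def)
qed

text \<open>Up to a constant, the projection of \<open>phi k\<close> to the functions that transform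
  under the group by \<xi>; it treats the four families uniformly.\<close>

definition trig :: "((int ^ 3 \<Rightarrow> int ^ 3) \<Rightarrow> complex) \<Rightarrow> int ^ 3 \<Rightarrow> real ^ 3 \<Rightarrow> complex" where
  "trig \<xi> k t = (\<Sum>g\<in>G2. \<xi> g * phi (g k) t)"

lemma chi_A2:
  assumes "\<sigma> \<in> A2"
  shows "chi_sc \<sigma> = 1" "chi_sc (- \<sigma>) = - 1" "chi_cs \<sigma> = G2_sign \<sigma>" "chi_cs (- \<sigma>) = - G2_sign \<sigma>"
  using assms unfolding A2_def
  by (elim insertE emptyE; simp add: chi_sc_def chi_cs_def vandermonde3_def G2_sign_A2)+

lemma CC_eq_trig: "CC k t = 1 / 12 * trig (\<lambda>_. 1) k t"
  by (simp add: CC_def trig_def sum_G2_A2)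

lemma SC_eq_trig: "SC k t = 1 / (12 * \<i>) * trig chi_sc k t"
  unfolding SC_def trig_def sum_G2_A2
  by (intro arg_cong2[where f = "(*)"] sum.cong refl) (simp add: chi_A2)

lemma CS_eq_trig: "CS k t = 1 / (12 * \<i>) * trig chi_cs k t"
  unfolding CS_def trig_def sum_G2_A2
  by (intro arg_cong2[where f = "(*)"] sum.cong refl) (simp add: chi_A2 algebra_simps)

lemma SS_eq_trig: "SS k t = - (1 / 12) * trig chi_ss k t"
  unfolding SS_def trig_def sum_G2_A2
  by (intro arg_cong2[where f = "(*)"] sum.cong refl) (simp add: chi_A2 chi_ss_def algebra_simps)

lemma sum_Upsilon_rot:
  "(\<Sum>j\<in>Upsilon n. of_real (omega n j) * f j) = (\<Sum>m\<in>Gamma_cc n. of_real (omega n (rot m)) * f (rot m))"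
  for f :: "int ^ 3 \<Rightarrow> complex"
  by (rule sum.reindex_bij_betw[OF bij_betw_rot, symmetric])

definition trig_node :: "((int ^ 3 \<Rightarrow> int ^ 3) \<Rightarrow> complex) \<Rightarrow> nat \<Rightarrow> int ^ 3 \<Rightarrow> int ^ 3 \<Rightarrow> complex" where
  "trig_node \<xi> n k m = (\<Sum>g\<in>G2. \<xi> g * echar n (bform (g k) m))"

lemma trig_node:
  assumes "n \<ge> 1" "k \<in> Hdag" "m \<in> Hdag"
  shows "trig \<xi> k (node n (rot m)) = trig_node \<xi> n k m"
  unfolding trig_def trig_node_def
  by (rule sum.cong[OF refl]) (simp add: phi_node_rot[OF assms(1) G2_Hdag[OF _ assms(2)] assms(3)])

text \<open>Moving \<open>g\<close> to the frequency side as its adjoint \<open>h\<close> and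
  reindexing leaves the factor \<open>\<xi> h\<close>. One \<open>h\<close> serves all frequencies,
  so the sign cancels in a product of two such sums.\<close>

lemma trig_node_G2:
  assumes "G2_char \<xi>" "k \<in> Hdag" "g \<in> G2"
  shows "\<exists>h\<in>G2. \<forall>k\<in>Hdag. \<forall>m\<in>Hdag. trig_node \<xi> n k (g m) = \<xi> h * trig_node \<xi> n k m"
proof -
  obtain h where h: "h \<in> G2" "\<And>k m. k \<in> Hdag \<Longrightarrow> m \<in> Hdag \<Longrightarrow> bform k (g m) = bform (h k) m"
    using bform_G2[OF assms(3)] by blast
  have hh: "\<xi> f = \<xi> h * \<xi> (h \<circ> f)" if "f \<in> G2" for f
  proof -
    have "\<xi> h * \<xi> (h \<circ> f) = (\<xi> h * \<xi> h) * \<xi> f" "\<xi> h * \<xi> h = 1"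
      using assms(1) h(1) that by (auto simp: G2_char_def)
    then show ?thesis
      by simp
  qed
  show ?thesis
  proof (intro bexI[of _ h] ballI h(1))
    fix k m :: "int ^ 3" assume km: "k \<in> Hdag" "m \<in> Hdag"
    have "trig_node \<xi> n k (g m) = (\<Sum>f\<in>G2. \<xi> h * (\<xi> (h \<circ> f) * echar n (bform ((h \<circ> f) k) m)))"
      unfolding trig_node_def
    proof (rule sum.cong[OF refl])
      fix f assume f: "f \<in> G2"
      then show "\<xi> f * echar n (bform (f k) (g m)) = \<xi> h * (\<xi> (h \<circ> f) * echar n (bform ((h \<circ> f) k) m))"
        using h(2)[OF G2_Hdag[OF f km(1)] km(2)] hh[OF f] by simp
    qed
    also have "\<dots> = \<xi> h * trig_node \<xi> n k m"
      unfolding trig_node_def sum_distrib_left[symmetric]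
      using sum_G2_comp(1)[OF h(1), of "\<lambda>f. \<xi> f * echar n (bform (f k) m)"] by simp
    finally show "trig_node \<xi> n k (g m) = \<xi> h * trig_node \<xi> n k m" .
  qed
qed

lemma trig_node_cong:
  assumes "n \<ge> 1" "veccong n x y"
  shows "trig_node \<xi> n k x = trig_node \<xi> n k y"
  unfolding trig_node_def by (intro sum.cong refl) (simp add: echar_bform_cong[OF assms])

text \<open>Orthogonality keeps the pairs with \<open>g j\<close> congruent to \<open>h k\<close>.
  Substituting \<open>g \<circ> h\<close> for \<open>h\<close> removes \<open>g\<close> from the
  condition and the coefficient, so the sum over \<open>g\<close> contributes 12.\<close>

lemma sum_residues_trig_node_product:
  assumes n: "n \<ge> 1" and chi: "G2_char \<xi>" and jk: "j \<in> Hdag" "k \<in> Hdag"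
  shows "(\<Sum>r\<in>residues_Hdag n. trig_node \<xi> n j r * cnj (trig_node \<xi> n k r))
    = 12 * of_nat n ^ 2 * (\<Sum>h\<in>G2. \<xi> h * of_bool (veccong n j (h k)))"
proof -
  have real: "cnj (\<xi> g) = \<xi> g" "\<xi> g * \<xi> g = 1" if "g \<in> G2" for g
    using chi that by (auto simp: G2_char_def)
  have "(\<Sum>r\<in>residues_Hdag n. trig_node \<xi> n j r * cnj (trig_node \<xi> n k r))
      = (\<Sum>r\<in>residues_Hdag n. \<Sum>g\<in>G2. \<Sum>h\<in>G2. \<xi> g * \<xi> h * echar n (bform (g j - h k) r))"
    unfolding trig_node_def cnj_sum sum_product
    by (intro sum.cong refl) (simp add: real cnj_echar bform_diff echar_add[symmetric] algebra_simps)
  also have "\<dots> = (\<Sum>g\<in>G2. \<Sum>h\<in>G2. \<xi> g * \<xi> h * (\<Sum>r\<in>residues_Hdag n. echar n (bform (g j - h k) r)))"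
    unfolding sum_distrib_left
    by (subst sum.swap, intro sum.cong refl, rule sum.swap)
  also have "\<dots> = (\<Sum>g\<in>G2. \<Sum>h\<in>G2. of_nat n ^ 2 * (\<xi> g * (\<xi> h * of_bool (veccong n (g j) (h k)))))"
  proof (intro sum.cong refl)
    fix g h assume "g \<in> G2" "h \<in> G2"
    then have "g j - h k \<in> Hdag"
      using G2_Hdag[OF _ jk(1), of g] G2_Hdag[OF _ jk(2), of h] by (simp add: Hdag_def)
    then show "\<xi> g * \<xi> h * (\<Sum>r\<in>residues_Hdag n. echar n (bform (g j - h k) r))
        = of_nat n ^ 2 * (\<xi> g * (\<xi> h * of_bool (veccong n (g j) (h k))))"
      by (simp add: sum_residues_echar[OF n] veccong_iff_diff[of n "g j" "h k"])
  qed
  also have "\<dots> = (\<Sum>g\<in>G2. \<Sum>h\<in>G2. of_nat n ^ 2 * (\<xi> h * of_bool (veccong n j (h k))))"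
  proof (rule sum.cong[OF refl])
    fix g assume g: "g \<in> G2"
    have "(\<Sum>h\<in>G2. of_nat n ^ 2 * (\<xi> g * (\<xi> h * of_bool (veccong n (g j) (h k)))))
        = (\<Sum>h\<in>G2. of_nat n ^ 2 * (\<xi> g * (\<xi> (g \<circ> h) * of_bool (veccong n (g j) ((g \<circ> h) k)))))"
      by (rule sum_G2_comp(1)[OF g, symmetric])
    also have "\<dots> = (\<Sum>h\<in>G2. of_nat n ^ 2 * (\<xi> h * of_bool (veccong n j (h k))))"
    proof (rule sum.cong[OF refl], rule arg_cong2[where f = "(*)", OF refl])
      fix h assume h: "h \<in> G2"
      have "\<xi> (g \<circ> h) = \<xi> g * \<xi> h"
        using chi g h by (auto simp: G2_char_def)
      then show "\<xi> g * (\<xi> (g \<circ> h) * of_bool (veccong n (g j) ((g \<circ> h) k))) = \<xi> h * of_bool (veccong n j (h k))"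
        using real(2)[OF g] by (simp add: veccong_G2_iff[OF g] mult.assoc[symmetric])
    qed
    finally show "(\<Sum>h\<in>G2. of_nat n ^ 2 * (\<xi> g * (\<xi> h * of_bool (veccong n (g j) (h k)))))
        = (\<Sum>h\<in>G2. of_nat n ^ 2 * (\<xi> h * of_bool (veccong n j (h k))))" .
  qed
  also have "\<dots> = 12 * of_nat n ^ 2 * (\<Sum>h\<in>G2. \<xi> h * of_bool (veccong n j (h k)))"
    unfolding sum_constant card_G2 sum_distrib_left[symmetric] by simp
  finally show ?thesis .
qed

text \<open>The condition on \<open>c\<close> holds for the normalizing constants of all four
  families. Folding reduces the inner product to a character sum over the maps taking
  \<open>k\<close> to \<open>j\<close> modulo \<open>n\<close>; by \<open>stab\<close> it counts the
  stabilizer when \<open>j = k\<close>, and otherwise no such map exists.\<close>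

lemma triangle_inner_trig:
  assumes n: "n \<ge> 1" and chi: "G2_char \<xi>" and jk: "j \<in> Gamma_cc n" "k \<in> Gamma_cc n"
    and stab: "\<And>g. g \<in> G2 \<Longrightarrow> veccong n (g k) k \<Longrightarrow> \<xi> g = 1"
    and c: "c * cnj c = 1 / 144"
  shows "triangle_inner n (\<lambda>t. c * trig \<xi> j t) (\<lambda>t. c * trig \<xi> k t) = of_bool (j = k) / of_real (omega n (hat k))"
proof -
  have H: "j \<in> Hdag" "k \<in> Hdag"
    using jk by (auto simp: Gamma_cc_def)
  define F where "F m = trig_node \<xi> n j m * cnj (trig_node \<xi> n k m)" for m
  have "triangle_inner n (\<lambda>t. c * trig \<xi> j t) (\<lambda>t. c * trig \<xi> k t)
      = 1 / of_nat n ^ 2 * (\<Sum>m\<in>Gamma_cc n. of_real (omega n (rot m)) *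
          (c * trig \<xi> j (node n (rot m)) * cnj (c * trig \<xi> k (node n (rot m)))))"
    unfolding triangle_inner_def mult.assoc by (subst sum_Upsilon_rot) (rule refl)
  also have "(\<Sum>m\<in>Gamma_cc n. of_real (omega n (rot m)) *
          (c * trig \<xi> j (node n (rot m)) * cnj (c * trig \<xi> k (node n (rot m)))))
      = (\<Sum>m\<in>Gamma_cc n. (c * cnj c) * (of_real (omega n (rot m)) * F m))"
  proof (intro sum.cong refl)
    fix m assume "m \<in> Gamma_cc n"
    then have m: "m \<in> Hdag"
      by (simp add: Gamma_cc_def)
    show "of_real (omega n (rot m)) * (c * trig \<xi> j (node n (rot m)) * cnj (c * trig \<xi> k (node n (rot m))))
        = (c * cnj c) * (of_real (omega n (rot m)) * F m)"
      by (simp add: F_def trig_node[OF n H(1) m] trig_node[OF n H(2) m])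
  qed
  also have "\<dots> = 1 / 144 * (\<Sum>m\<in>Gamma_cc n. of_real (omega n (rot m)) * F m)"
    by (simp only: c sum_distrib_left)
  also have "(\<Sum>m\<in>Gamma_cc n. of_real (omega n (rot m)) * F m) = (\<Sum>r\<in>residues_Hdag n. F r)"
  proof (rule sum_Upsilon_fold[OF n])
    fix g x assume gx: "g \<in> G2" "x \<in> Hdag"
    obtain h where h: "h \<in> G2" "\<And>k m. k \<in> Hdag \<Longrightarrow> m \<in> Hdag \<Longrightarrow> trig_node \<xi> n k (g m) = \<xi> h * trig_node \<xi> n k m"
      using trig_node_G2[OF chi H(1) gx(1)] by blast
    have "\<xi> h = 1 \<or> \<xi> h = - 1"
      using chi h(1) by (auto simp: G2_char_def)
    then show "F (g x) = F x"
      using h(2)[OF H(1) gx(2)] h(2)[OF H(2) gx(2)] by (auto simp: F_def)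
  qed (simp add: F_def trig_node_cong[OF n])
  also have "\<dots> = 12 * of_nat n ^ 2 * (\<Sum>h\<in>G2. \<xi> h * of_bool (veccong n j (h k)))"
    unfolding F_def by (rule sum_residues_trig_node_product[OF n chi H])
  finally have *: "triangle_inner n (\<lambda>t. c * trig \<xi> j t) (\<lambda>t. c * trig \<xi> k t)
      = (\<Sum>h\<in>G2. \<xi> h * of_bool (veccong n j (h k))) / 12"
    using n by simp
  show ?thesis
  proof (cases "j = k")
    case False
    then have "\<not> veccong n j (h k)" if "h \<in> G2" for h
      using Gamma_cc_veccong_unique[OF n jk(2,1) that] veccong_sym by blast
    then show ?thesis
      using False by (simp add: *)
  next
    case True
    have "(\<Sum>h\<in>G2. \<xi> h * of_bool (veccong n j (h k))) = (\<Sum>h\<in>G2. if veccong n (h k) k then 1 else 0)"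
      using stab by (intro sum.cong refl) (auto simp: True veccong_sym)
    also have "\<dots> = of_nat (card {h \<in> G2. veccong n (h k) k})"
      by (simp add: sum.If_cases Int_def)
    finally have "triangle_inner n (\<lambda>t. c * trig \<xi> j t) (\<lambda>t. c * trig \<xi> k t)
        = of_real (real (card {h \<in> G2. veccong n (h k) k}) / 12)"
      by (simp add: *)
    also have "real (card {h \<in> G2. veccong n (h k) k}) / 12 = 1 / omega n (hat k)"
    proof -
      have 12: "omega n (hat k) * real (card {h \<in> G2. veccong n (h k) k}) = 12"
        using card_veccong_stabilizer_weight[OF n jk(2)] omega_hat_rot(1)[OF n jk(2)] by simp
      then have "omega n (hat k) \<noteq> 0"
        by auto
      with 12 show ?thesis
        by (simp add: field_simps)
    qed
    finally show ?thesis
      by (simp add: True)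
  qed
qed

text \<open>Replaces divisibility by linear alternatives, as needed in arithmetic case
  distinctions.\<close>

lemma veccong_nth_cases:
  assumes "veccong n x y"
  shows "x $ i = y $ i \<or> \<bar>x $ i - y $ i\<bar> \<ge> int n"
  using assms dvd_imp_le_int[of "x $ i - y $ i" "int n"] by (auto simp: veccong_def)

text \<open>The maps of character -1 are excluded one by one: each coordinate of \<open>g k\<close>
  equals that of \<open>k\<close> or differs from it by at least \<open>n\<close>, and the strict
  inequalities leave no consistent choice.\<close>

lemma Gamma_stabilizer_char:
  assumes "g \<in> G2" "veccong n (g k) k"
  shows "k \<in> Gamma_sc n \<Longrightarrow> chi_sc g = 1"
    and "k \<in> Gamma_cs n \<Longrightarrow> chi_cs g = 1"
    and "k \<in> Gamma_ss n \<Longrightarrow> chi_ss g = 1"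
proof -
  note c = veccong_nth_cases[OF assms(2), of 1] veccong_nth_cases[OF assms(2), of 2] veccong_nth_cases[OF assms(2), of 3]
  show "k \<in> Gamma_sc n \<Longrightarrow> chi_sc g = 1"
    using assms(1) c unfolding G2_elements Gamma_sc_def Hdag_def
    by (elim insertE emptyE; simp add: chi_sc_def vandermonde3_def; smt (verit))
  show "k \<in> Gamma_cs n \<Longrightarrow> chi_cs g = 1"
    using assms(1) c unfolding G2_elements Gamma_cs_def Hdag_def
    by (elim insertE emptyE; simp add: chi_cs_def; smt (verit))
  show "k \<in> Gamma_ss n \<Longrightarrow> chi_ss g = 1"
    using assms(1) c unfolding G2_elements Gamma_ss_def Hdag_def
    by (elim insertE emptyE; simp add: chi_ss_def chi_cs_def chi_sc_def vandermonde3_def; smt (verit))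
qed

lemma omega_hat_Gamma_ss:
  assumes "n \<ge> 1" "k \<in> Gamma_ss n"
  shows "omega n (hat k) = 12"
proof -
  have k: "k $ 1 + k $ 2 + k $ 3 = 0" "0 < k $ 2" "k $ 2 < k $ 1"
    using assms(2) by (auto simp: Gamma_ss_def Hdag_def)
  have "g = id" if g: "g \<in> G2" "g k = k" for g
  proof -
    have "g k $ 1 = k $ 1" "g k $ 2 = k $ 2" "g k $ 3 = k $ 3"
      by (simp_all add: g(2))
    with g(1) k show ?thesis
      unfolding G2_elements by (elim insertE emptyE) simp_all
  qed
  then have "{g \<in> G2. g k = k} = {id}"
    by auto
  then have "card (G2_orbit k) = 12"
    using card_G2_orbit[of k] by simp
  moreover have "k \<in> Gamma_cc n" "wall_weight n k = 1"
    using assms(2) by (auto simp: Gamma_cc_def Gamma_ss_def wall_weight_def)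
  ultimately show ?thesis
    using omega_hat_rot(1)[OF assms(1), of k] by simp
qed


section \<open>Integration over the triangle\<close>

lemma has_vector_derivative_cis_affine:
  "((\<lambda>x. cis (p * x + q)) has_vector_derivative \<i> * of_real p * cis (p * x + q)) (at x within S)"
proof -
  have "((\<lambda>z. exp (\<i> * (of_real p * z + of_real q))) has_field_derivative
      \<i> * of_real p * exp (\<i> * (of_real p * of_real x + of_real q))) (at (of_real x))"
    by (auto intro!: derivative_eq_intros)
  from has_vector_derivative_real_field[OF this, of S] show ?thesis
    by (simp add: cis_conv_exp)
qed

lemma phi_plane:
  "phi k (vector [x, y, - x - y])
    = cis (2 * pi / 3 * (of_int (k $ 1 - k $ 3) * x + of_int (k $ 2 - k $ 3) * y))"
proof -
  have "rvec k \<bullet> vector [x, y, - x - y] = of_int (k $ 1 - k $ 3) * x + of_int (k $ 2 - k $ 3) * y"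
    by (simp add: rvec_def inner_vec_def sum_3 algebra_simps)
  then show ?thesis
    by (simp add: phi_def cis_conv_exp mult_ac)
qed

text \<open>The exponential \<open>phi k\<close> in the coordinates \<open>x = t1\<close>,
  \<open>y = t2\<close>, where \<open>a = k1 - k3\<close> and \<open>b = k2 - k3\<close>.\<close>

definition wave :: "real \<Rightarrow> real \<Rightarrow> real \<Rightarrow> real \<Rightarrow> complex" where
  "wave a b x y = cis (2 * pi / 3 * (a * x + b * y))"

lemma continuous_on_wave [continuous_intros]:
  assumes "continuous_on S f" "continuous_on S g"
  shows "continuous_on S (\<lambda>y. wave a b (f y) (g y))"
  unfolding wave_def cis_conv_exp using assms by (intro continuous_intros)

text \<open>Closed form of the inner integral over \<open>x\<close> from \<open>y\<close> to
  \<open>1 - y\<close>, chosen so that it can be differentiated in \<open>y\<close>.\<close>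

definition section_integral :: "real \<Rightarrow> real \<Rightarrow> real \<Rightarrow> complex" where
  "section_integral a b y =
    (if a = 0 then of_real (1 - 2 * y) * wave a b 0 y
     else (wave a b (1 - y) y - wave a b y y) / (2 * pi / 3 * \<i> * a))"

lemma wave_has_vector_derivative:
  "((\<lambda>y. wave a b (p * y + q) (r * y + s)) has_vector_derivative
     2 * pi / 3 * \<i> * (a * p + b * r) * wave a b (p * y + q) (r * y + s)) (at y within S)"
proof -
  define P Q where "P = 2 * pi / 3 * (a * p + b * r)" and "Q = 2 * pi / 3 * (a * q + b * s)"
  have "wave a b (p * y + q) (r * y + s) = cis (P * y + Q)" for y
    unfolding wave_def P_def Q_def by (rule arg_cong[of _ _ cis]) (simp add: field_simps)
  moreover have "2 * pi / 3 * \<i> * (of_real a * of_real p + of_real b * of_real r) = \<i> * P"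
    by (simp add: P_def)
  ultimately show ?thesis
    using has_vector_derivative_cis_affine[of P Q y S] by (simp only:)
qed

lemma integral_wave_section:
  assumes "y \<in> {0..1/2}"
  shows "(LINT x : {y..1 - y} | lborel. wave a b x y) = section_integral a b y"
proof -
  have le: "y \<le> 1 - y"
    using assms by simp
  have cont: "continuous_on {y..1 - y} (\<lambda>x. wave a b x y)"
    by (intro continuous_intros)
  show ?thesis
  proof (cases "a = 0")
    case True
    then have "(\<lambda>x. wave a b x y) = (\<lambda>x. wave a b 0 y)"
      by (simp add: wave_def)
    then show ?thesis
      using le True by (simp add: section_integral_def set_lebesgue_integral_def scaleR_conv_of_real)
  next
    case False
    define F where "F x = wave a b x y / (2 * pi / 3 * \<i> * a)" for x
    have "(F has_vector_derivative wave a b x y) (at x within S)" for x S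
    proof -
      have "(F has_vector_derivative (2 * pi / 3 * \<i> * a * wave a b x y) / (2 * pi / 3 * \<i> * a)) (at x within S)"
        unfolding F_def
        by (intro has_vector_derivative_divide) (use wave_has_vector_derivative[of a b 1 0 0 y x S] in simp)
      then show ?thesis
        using False by simp
    qed
    then have "(LINT x : {y..1 - y} | lborel. wave a b x y) = F (1 - y) - F y"
      unfolding set_lebesgue_integral_def using cont le
      by (intro integral_FTC_atLeastAtMost) auto
    then show ?thesis
      using False by (simp add: F_def section_integral_def diff_divide_distrib)
  qed
qed

text \<open>Valid for \<open>a = 0\<close> too, since the wave is then independent of
  \<open>x\<close> and both sides vanish.\<close>

lemma section_integral_mult_a:
  "2 * pi / 3 * \<i> * a * section_integral a b y = wave a b (1 - y) y - wave a b y y"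
  by (simp add: section_integral_def wave_def)

text \<open>Leibniz rule: the first term differentiates the integrand, the other two come from the
  moving end points \<open>1 - y\<close> and \<open>y\<close>.\<close>

lemma section_integral_has_vector_derivative:
  "(section_integral a b has_vector_derivative
     2 * pi / 3 * \<i> * b * section_integral a b y - wave a b (1 - y) y - wave a b y y) (at y within S)"
proof -
  have d0: "(wave a b 0 has_vector_derivative 2 * pi / 3 * \<i> * b * wave a b 0 y) (at y within S)"
    using wave_has_vector_derivative[of a b 0 0 1 0 y S] by simp
  have d1: "((\<lambda>y. wave a b (1 - y) y) has_vector_derivative 2 * pi / 3 * \<i> * (b - a) * wave a b (1 - y) y) (at y within S)"
    using wave_has_vector_derivative[of a b "-1" 1 1 0 y S] by (simp add: algebra_simps)
  have d2: "((\<lambda>y. wave a b y y) has_vector_derivative 2 * pi / 3 * \<i> * (a + b) * wave a b y y) (at y within S)"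
    using wave_has_vector_derivative[of a b 1 0 1 0 y S] by simp
  show ?thesis
  proof (cases "a = 0")
    case True
    have "((\<lambda>y. of_real (1 - 2 * y) * wave a b 0 y) has_vector_derivative
        of_real (1 - 2 * y) * (2 * pi / 3 * \<i> * b * wave a b 0 y) + of_real (- 2) * wave a b 0 y) (at y within S)"
      by (intro has_vector_derivative_mult d0) (auto intro!: derivative_eq_intros simp: has_real_derivative_iff_has_vector_derivative[symmetric])
    then show ?thesis
      using True unfolding section_integral_def[abs_def] by (simp add: wave_def algebra_simps)
  next
    case False
    have "((\<lambda>y. (wave a b (1 - y) y - wave a b y y) / (2 * pi / 3 * \<i> * a)) has_vector_derivative
        (2 * pi / 3 * \<i> * (b - a) * wave a b (1 - y) y - 2 * pi / 3 * \<i> * (a + b) * wave a b y y)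
          / (2 * pi / 3 * \<i> * a)) (at y within S)"
      by (intro has_vector_derivative_divide has_vector_derivative_diff d1 d2)
    also have "(2 * pi / 3 * \<i> * (b - a) * wave a b (1 - y) y - 2 * pi / 3 * \<i> * (a + b) * wave a b y y)
          / (2 * pi / 3 * \<i> * a)
        = 2 * pi / 3 * \<i> * b * section_integral a b y - wave a b (1 - y) y - wave a b y y"
      using False by (simp add: section_integral_def field_simps)
    finally show ?thesis
      using False unfolding section_integral_def[abs_def] by simp
  qed
qed

lemma continuous_on_section_integral: "continuous_on S (section_integral a b)"
  unfolding continuous_on_eq_continuous_within
  using section_integral_has_vector_derivative has_vector_derivative_continuous by blast

definition mean_integral :: "real \<Rightarrow> real \<Rightarrow> complex" where
  "mean_integral a b = integral {0..1/2} (section_integral a b)"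

text \<open>\<open>edge1\<close> belongs to the edge \<open>t3 = -1\<close> and \<open>edge2\<close>
  to \<open>t1 = t2\<close>, both parametrized by \<open>y = t2\<close>. The edge
  \<open>t2 = 0\<close> enters as \<open>section_integral a b 0\<close>.\<close>

definition edge1 :: "real \<Rightarrow> real \<Rightarrow> complex" where
  "edge1 a b = integral {0..1/2} (\<lambda>y. wave a b (1 - y) y)"

definition edge2 :: "real \<Rightarrow> real \<Rightarrow> complex" where
  "edge2 a b = integral {0..1/2} (\<lambda>y. wave a b y y)"

lemma mean_integral_mult_a:
  "2 * pi / 3 * \<i> * a * mean_integral a b = edge1 a b - edge2 a b"
proof -
  have "edge1 a b - edge2 a b = integral {0..1/2} (\<lambda>y. wave a b (1 - y) y - wave a b y y)"
    unfolding edge1_def edge2_def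
    by (intro Henstock_Kurzweil_Integration.integral_diff[symmetric] integrable_continuous_interval continuous_intros)
  also have "\<dots> = integral {0..1/2} (\<lambda>y. 2 * pi / 3 * \<i> * a * section_integral a b y)"
    by (simp only: section_integral_mult_a)
  finally show ?thesis
    by (simp add: mean_integral_def)
qed

lemma mean_integral_mult_b:
  "2 * pi / 3 * \<i> * b * mean_integral a b = edge1 a b + edge2 a b - section_integral a b 0"
proof -
  have int: "section_integral a b integrable_on {0..1/2}"
    "(\<lambda>y. wave a b (1 - y) y) integrable_on {0..1/2}" "(\<lambda>y. wave a b y y) integrable_on {0..1/2}"
    by (intro integrable_continuous_interval continuous_intros continuous_on_section_integral)+
  have "((\<lambda>y. 2 * pi / 3 * \<i> * b * section_integral a b y - wave a b (1 - y) y - wave a b y y)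
      has_integral section_integral a b (1/2) - section_integral a b 0) {0..1/2}"
    by (intro fundamental_theorem_of_calculus section_integral_has_vector_derivative) simp
  moreover have "((\<lambda>y. 2 * pi / 3 * \<i> * b * section_integral a b y - wave a b (1 - y) y - wave a b y y)
      has_integral 2 * pi / 3 * \<i> * b * mean_integral a b - edge1 a b - edge2 a b) {0..1/2}"
    unfolding mean_integral_def edge1_def edge2_def
    by (intro has_integral_diff has_integral_mult_right integrable_integral int)
  ultimately have "2 * pi / 3 * \<i> * b * mean_integral a b - edge1 a b - edge2 a b
      = section_integral a b (1/2) - section_integral a b 0"
    by (rule has_integral_unique[rotated])
  \<comment> \<open>At \<open>y = 1/2\<close> the section shrinks to a point.\<close>
  moreover have "section_integral a b (1/2) = 0"
    by (simp add: section_integral_def)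
  ultimately show ?thesis
    by (simp add: algebra_simps)
qed

lemma triangle_mean_phi:
  "triangle_mean (phi k) = 4 * mean_integral (of_int (k $ 1 - k $ 3)) (of_int (k $ 2 - k $ 3))"
proof -
  define a b where "a = real_of_int (k $ 1 - k $ 3)" and "b = real_of_int (k $ 2 - k $ 3)"
  have "continuous_on triangle (phi k)"
    unfolding phi_def by (intro continuous_intros) auto
  then have "triangle_mean (phi k)
      = 4 * (LINT y : {0..1/2} | lborel. LINT x : {y..1 - y} | lborel. wave a b x y)"
    by (simp add: triangle_mean_iterated phi_plane wave_def a_def b_def)
  also have "(LINT y : {0..1/2} | lborel. LINT x : {y..1 - y} | lborel. wave a b x y)
      = (LINT y : {0..1/2} | lborel. section_integral a b y)"
    by (rule set_lebesgue_integral_cong) (use integral_wave_section in auto)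
  also have "\<dots> = mean_integral a b"
    unfolding mean_integral_def
    by (intro set_borel_integral_eq_integral borel_integrable_atLeastAtMost' continuous_on_section_integral)
  finally show ?thesis
    by (simp add: a_def b_def)
qed

lemma triangle_mean_1: "triangle_mean (\<lambda>_. 1) = 1"
proof -
  have "phi 0 = (\<lambda>_. 1)"
    by (simp add: phi_def rvec_def inner_vec_def fun_eq_iff)
  moreover have "mean_integral 0 0 = 1 / 4"
  proof -
    have "((\<lambda>y. 1 - 2 * y) has_integral (1/2 - (1/2)\<^sup>2) - (0 - 0\<^sup>2)) {0..1/2 :: real}"
      by (intro fundamental_theorem_of_calculus)
        (auto intro!: derivative_eq_intros simp: has_real_derivative_iff_has_vector_derivative[symmetric])
    from has_integral_linear[OF this bounded_linear_of_real[where 'a = complex]]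
    have "((\<lambda>y. of_real (1 - 2 * y)) has_integral (1 / 4 :: complex)) {0..1/2}"
      by (simp add: o_def power2_eq_square)
    then have "integral {0..1/2} (\<lambda>y. of_real (1 - 2 * y)) = (1 / 4 :: complex)"
      by (rule integral_unique)
    then show ?thesis
      by (simp add: mean_integral_def section_integral_def[abs_def] wave_def)
  qed
  moreover have "triangle_mean (phi 0) = 4 * mean_integral 0 0"
    using triangle_mean_phi[of 0] by simp
  ultimately show ?thesis
    by (simp only:) simp
qed

text \<open>Integration by parts (the divergence theorem) turns the integral of an exponential over the
  triangle into integrals of its normal derivative along the three edges. Each of these is odd under
  the reflection in the edge, so they cancel in the sum over the group.\<close>

lemma sum_G2_mean_integral:
  assumes "k \<in> Hdag" "k \<noteq> 0"
  shows "(\<Sum>g\<in>G2. triangle_mean (phi (g k))) = 0"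
proof -
  define a b where "a k = real_of_int (k $ 1 - k $ 3)" and "b k = real_of_int (k $ 2 - k $ 3)" for k :: "int ^ 3"
  define I where "I k = mean_integral (a k) (b k)" for k
  \<comment> \<open>In the oblique coordinates \<open>(t1, t2)\<close> the gradient of the
    exponential is, up to a scalar factor, in the direction \<open>(a - b/2, b - a/2)\<close>.
    \<open>X1\<close>, \<open>X2\<close>, \<open>X3\<close> come from its flux through the three
    edges, and \<open>Q\<close> is, up to a factor, the Laplace eigenvalue.\<close>
  define X1 where "X1 k = (a k + b k) / 2 * edge1 (a k) (b k)" for k
  define X2 where "X2 k = 3 / 2 * (b k - a k) * edge2 (a k) (b k)" for k
  define X3 where "X3 k = (b k - a k / 2) * section_integral (a k) (b k) 0" for k
  define Q where "Q k = (a k)\<^sup>2 - a k * b k + (b k)\<^sup>2" for k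
  have odd: "(\<Sum>g\<in>G2. X (g k)) = 0"
    if "\<rho> \<in> G2" "\<And>k. k \<in> Hdag \<Longrightarrow> X (\<rho> k) = - X k" for \<rho> and X :: "int ^ 3 \<Rightarrow> complex"
  proof -
    have "(\<Sum>g\<in>G2. X (g k)) = (\<Sum>g\<in>G2. X ((\<rho> \<circ> g) k))"
      by (rule sum_G2_comp(1)[OF that(1), symmetric])
    also have "\<dots> = (\<Sum>g\<in>G2. - X (g k))"
      by (rule sum.cong[OF refl]) (simp add: that(2)[OF G2_Hdag[OF _ assms(1)]])
    finally show ?thesis
      by (simp add: sum_negf)
  qed
  have main: "2 * pi / 3 * \<i> * Q k * I k = X1 k + X2 k - X3 k" for k
  proof -
    have "2 * pi / 3 * \<i> * Q k * I k = (a k - b k / 2) * (2 * pi / 3 * \<i> * a k * I k)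
        + (b k - a k / 2) * (2 * pi / 3 * \<i> * b k * I k)"
      by (simp add: Q_def power2_eq_square field_simps)
    also have "\<dots> = X1 k + X2 k - X3 k"
      unfolding I_def mean_integral_mult_a mean_integral_mult_b X1_def X2_def X3_def
      by (simp add: field_simps)
    finally show ?thesis .
  qed
  have "X1 (sigma2 k) = - X1 k" if k: "k \<in> Hdag" for k
  proof -
    have k3: "k $ 1 + k $ 2 = - k $ 3"
      using k by (simp add: Hdag_def)
    have ab: "a (sigma2 k) = - b k" "b (sigma2 k) = - a k"
      by (simp_all add: a_def b_def)
    have "a k + b k = of_int (k $ 1 + k $ 2 - 2 * k $ 3)"
      by (simp add: a_def b_def)
    then have sum: "a k + b k = - 3 * of_int (k $ 3)"
      unfolding k3 by simp
    \<comment> \<open>\<open>sigma2\<close> is the linear part of the reflection in the edge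
      \<open>t3 = -1\<close>. On that edge it shifts points by \<open>(-1, -1, 2)\<close>, which for
      \<open>k\<close> in \<open>Hdag\<close> changes the phase by a multiple of
      \<open>2 pi\<close>.\<close>
    have "wave (- b k) (- a k) (1 - y) y = wave (a k) (b k) (1 - y) y" for y
    proof -
      have "2 * pi / 3 * (a k * (1 - y) + b k * y)
          = 2 * pi / 3 * (- b k * (1 - y) + - a k * y) + 2 * pi / 3 * (a k + b k)"
        by (simp add: field_simps)
      also have "2 * pi / 3 * (a k + b k) = 2 * pi * of_int (- k $ 3)"
        by (simp add: sum)
      finally show ?thesis
        unfolding wave_def by (simp only: cis_mult[symmetric] cis_multiple_2pi Ints_of_int mult_1_right)
    qed
    then show ?thesis
      by (simp add: X1_def edge1_def ab algebra_simps)
  qed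
  then have "(\<Sum>g\<in>G2. X1 (g k)) = 0"
    by (intro odd[of sigma2]) (simp_all add: G2_elements)
  \<comment> \<open>The other two edges lie on lines through the origin, fixed pointwise by
    \<open>- sigma2\<close> and \<open>sigma3\<close>, so no phase shift arises.\<close>
  moreover have "(\<Sum>g\<in>G2. X2 (g k)) = 0"
  proof (rule odd[of "- sigma2"])
    fix k
    have "a (- sigma2 k) = b k" "b (- sigma2 k) = a k"
      by (simp_all add: a_def b_def)
    moreover have "edge2 (b k) (a k) = edge2 (a k) (b k)"
      by (simp add: edge2_def wave_def add.commute)
    moreover have "3 / 2 * (a k - b k) = - (3 / 2 * (b k - a k))"
      by (simp add: field_simps)
    ultimately show "X2 ((- sigma2) k) = - X2 k"
      by (simp only: X2_def fun_Compl_def of_real_minus mult_minus_left)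
  qed (simp add: G2_elements)
  moreover have "(\<Sum>g\<in>G2. X3 (g k)) = 0"
  proof (rule odd[of sigma3])
    fix k
    have "a (sigma3 k) = a k" "b (sigma3 k) = a k - b k"
      by (simp_all add: a_def b_def)
    moreover have "section_integral (a k) (a k - b k) 0 = section_integral (a k) (b k) 0"
      by (simp add: section_integral_def wave_def)
    moreover have "a k - b k - a k / 2 = - (b k - a k / 2)"
      by simp
    ultimately show "X3 (sigma3 k) = - X3 k"
      by (simp only: X3_def of_real_minus mult_minus_left)
  qed (simp add: G2_elements)
  ultimately have "(\<Sum>g\<in>G2. 2 * pi / 3 * \<i> * Q (g k) * I (g k)) = 0"
    by (simp only: main sum.distrib sum_subtractf) simp
  moreover have "Q (g k) = Q k" if "g \<in> G2" for g
    using that unfolding G2_elements Q_def a_def b_def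
    by (elim insertE emptyE) (simp_all add: power2_eq_square algebra_simps)
  ultimately have "2 * pi / 3 * \<i> * Q k * (\<Sum>g\<in>G2. I (g k)) = 0"
    by (simp add: sum_distrib_left)
  moreover have "Q k \<noteq> 0"
  proof
    assume Q0: "Q k = 0"
    have "2 * Q k = (a k)\<^sup>2 + (b k)\<^sup>2 + (a k - b k)\<^sup>2"
      by (simp add: Q_def power2_eq_square algebra_simps)
    with Q0 have "a k = 0 \<and> b k = 0"
      by (smt (verit) zero_le_power2 zero_eq_power2)
    then show False
      using assms by (simp add: a_def b_def Hdag_def vec3_eq_iff)
  qed
  ultimately have "(\<Sum>g\<in>G2. I (g k)) = 0"
    by simp
  then have "4 * (\<Sum>g\<in>G2. I (g k)) = 0"
    by simp
  then show ?thesis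
    by (simp add: triangle_mean_phi I_def a_def b_def sum_distrib_left)
qed

section \<open>Linearity of the mean over the triangle\<close>

lemma compact_triangle_parameters: "compact (plane_pt -` triangle)"
proof -
  have D: "plane_pt -` triangle = {p. 0 \<le> snd p} \<inter> {p. snd p \<le> 1/2} \<inter> {p. snd p \<le> fst p} \<inter> {p. fst p \<le> 1 - snd p}"
    by (auto simp: plane_pt_triangle_iff)
  have "closed (plane_pt -` triangle)"
    unfolding D by (intro closed_Int closed_Collect_le continuous_intros)
  moreover have "plane_pt -` triangle \<subseteq> cbox (0, 0) (1, 1)"
    by (auto simp: D cbox_Pair_eq)
  ultimately show ?thesis
    by (meson bounded_cbox bounded_subset compact_eq_bounded_closed)
qed

lemma set_integrable_triangle:
  fixes f :: "real ^ 3 \<Rightarrow> complex"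
  assumes "continuous_on triangle f"
  shows "set_integrable lborel (plane_pt -` triangle) (\<lambda>p. f (plane_pt p))"
proof -
  have "continuous_on (plane_pt -` triangle) (\<lambda>p. f (plane_pt p))"
    by (rule continuous_on_compose2[OF assms continuous_plane_pt]) auto
  from borel_integrable_compact[OF compact_triangle_parameters this] show ?thesis
    unfolding set_integrable_def by (simp add: indicator_def if_distrib cong: if_cong)
qed

lemma triangle_mean_add:
  assumes "continuous_on triangle f" "continuous_on triangle g"
  shows "triangle_mean (\<lambda>t. f t + g t) = triangle_mean f + triangle_mean g"
  unfolding triangle_mean_def
  by (simp add: set_integral_add(2)[OF set_integrable_triangle set_integrable_triangle] assms distrib_left)

lemma triangle_mean_cmult: "triangle_mean (\<lambda>t. c * f t) = c * triangle_mean f"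
  unfolding triangle_mean_def by simp

lemma triangle_mean_sum:
  assumes "\<And>i. i \<in> A \<Longrightarrow> continuous_on triangle (f i)" "finite A"
  shows "triangle_mean (\<lambda>t. \<Sum>i\<in>A. f i t) = (\<Sum>i\<in>A. triangle_mean (f i))"
  using assms(2,1)
proof (induction A rule: finite_induct)
  case empty
  then show ?case
    using triangle_mean_cmult[of 0] by simp
next
  case (insert i A)
  then show ?case
    by (simp add: triangle_mean_add continuous_on_sum)
qed

lemma continuous_on_phi: "continuous_on S (phi k)"
  unfolding phi_def by (intro continuous_intros) auto

lemma continuous_on_CC: "continuous_on S (CC k)"
  unfolding CC_eq_trig[abs_def] trig_def by (intro continuous_intros continuous_on_phi)

lemma triangle_mean_CC:
  assumes "k \<in> Hdag"
  shows "triangle_mean (CC k) = of_bool (k = 0)"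
proof -
  have "triangle_mean (CC k) = 1 / 12 * (\<Sum>g\<in>G2. triangle_mean (phi (g k)))"
    unfolding CC_eq_trig[abs_def] trig_def triangle_mean_cmult
    by (subst triangle_mean_sum) (simp_all add: continuous_on_phi)
  also have "\<dots> = of_bool (k = 0)"
  proof (cases "k = 0")
    case True
    have "phi (g k) = (\<lambda>_. 1)" if "g \<in> G2" for g
      using G2_add[OF that, of 0 0] by (simp add: True phi_def rvec_def inner_vec_def fun_eq_iff)
    then show ?thesis
      by (simp add: True triangle_mean_1 card_G2)
  qed (use sum_G2_mean_integral[OF assms] in simp)
  finally show ?thesis .
qed


section \<open>The quadrature formula\<close>

text \<open>Folding turns the rule into an average of characters over \<open>Hdag / n Hdag\<close>,
  and whether a frequency is zero modulo \<open>n\<close> is the same throughout its orbit.\<close>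

lemma node_sum_CC:
  assumes n: "n \<ge> 1" and k: "k \<in> Hdag"
  shows "1 / of_nat n ^ 2 * (\<Sum>j\<in>Upsilon n. of_real (omega n j) * CC k (node n j)) = of_bool (veccong n k 0)"
proof -
  have "(\<Sum>j\<in>Upsilon n. of_real (omega n j) * CC k (node n j))
      = (\<Sum>m\<in>Gamma_cc n. of_real (omega n (rot m)) * CC k (node n (rot m)))"
    by (rule sum_Upsilon_rot)
  also have "\<dots> = (\<Sum>m\<in>Gamma_cc n. of_real (omega n (rot m)) * (1 / 12 * trig_node (\<lambda>_. 1) n k m))"
  proof (rule sum.cong[OF refl])
    fix m assume "m \<in> Gamma_cc n"
    then have "m \<in> Hdag"
      by (simp add: Gamma_cc_def)
    then show "of_real (omega n (rot m)) * CC k (node n (rot m))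
        = of_real (omega n (rot m)) * (1 / 12 * trig_node (\<lambda>_. 1) n k m)"
      by (simp add: CC_eq_trig trig_node[OF n k])
  qed
  also have "\<dots> = (\<Sum>r\<in>residues_Hdag n. 1 / 12 * trig_node (\<lambda>_. 1) n k r)"
  proof (rule sum_Upsilon_fold[OF n])
    show "1 / 12 * trig_node (\<lambda>_. 1) n k (g x) = 1 / 12 * trig_node (\<lambda>_. 1) n k x" if "g \<in> G2" "x \<in> Hdag" for g x
      using trig_node_G2[OF G2_char_1 k that(1)] that(2) k by fastforce
  qed (simp add: trig_node_cong[OF n])
  also have "\<dots> = 1 / 12 * (\<Sum>g\<in>G2. \<Sum>r\<in>residues_Hdag n. echar n (bform (g k) r))"
    unfolding trig_node_def sum_distrib_left[symmetric] by (subst sum.swap) simp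
  also have "(\<Sum>g\<in>G2. \<Sum>r\<in>residues_Hdag n. echar n (bform (g k) r)) = (\<Sum>g\<in>G2. of_nat n ^ 2 * of_bool (veccong n k 0))"
  proof (rule sum.cong[OF refl])
    fix g assume g: "g \<in> G2"
    have "g 0 = 0"
      using G2_add[OF g, of 0 0] by simp
    then have "veccong n (g k) 0 \<longleftrightarrow> veccong n k 0"
      using veccong_G2_iff[OF g, of n k 0] by simp
    then show "(\<Sum>r\<in>residues_Hdag n. echar n (bform (g k) r)) = of_nat n ^ 2 * of_bool (veccong n k 0)"
      by (simp add: sum_residues_echar[OF n G2_Hdag[OF g k]])
  qed
  also have "\<dots> = 12 * (of_nat n ^ 2 * of_bool (veccong n k 0))"
    unfolding sum_constant card_G2 by simp
  finally show ?thesis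
    using n by simp
qed

text \<open>With \<open>k3 = - k1 - k2\<close> the last inequality reads
  \<open>2 k1 + k2 \<le> 2 n - 1\<close>, so \<open>k1 < n\<close>. In
  \<open>Gamma_cc (2 * n)\<close> the point \<open>(n, 0, -n)\<close> would be a nonzero
  example.\<close>

lemma veccong_0_Gamma_cc:
  assumes "n \<ge> 1" "k \<in> Gamma_cc (2 * n - 1)" "veccong n k 0"
  shows "k = 0"
proof -
  have "int (2 * n - 1) = 2 * int n - 1"
    using assms(1) by simp
  then show ?thesis
    using veccong_nth_cases[OF assms(3), of 1] veccong_nth_cases[OF assms(3), of 2] assms(1,2)
    by (auto simp: Gamma_cc_def Hdag_def vec3_eq_iff)
qed

lemma quadrature:
  assumes n: "n \<ge> 1" and "f \<in> H_cc (2 * n - 1)"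
  shows "triangle_mean f = 1 / of_nat n ^ 2 * (\<Sum>j\<in>Upsilon n. of_real (omega n j) * f (node n j))"
proof -
  define q where "q f = 1 / of_nat n ^ 2 * (\<Sum>j\<in>Upsilon n. of_real (omega n j) * f (node n j))"
    for f :: "real ^ 3 \<Rightarrow> complex"
  \<comment> \<open>Continuity is carried through the induction because additivity of the mean
    requires integrability.\<close>
  have "continuous_on triangle f \<and> triangle_mean f = q f"
    using assms(2) unfolding H_cc_def
  proof (induction f rule: cfun.span_induct_alt)
    case base
    then show ?case
      using triangle_mean_cmult[of 0] by (simp add: q_def zero_fun_def)
  next
    case (step c x y)
    then obtain k where k: "k \<in> Gamma_cc (2 * n - 1)" "x = CC k"
      by blast
    have "k \<in> Hdag"
      using k(1) by (simp add: Gamma_cc_def)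
    moreover have "k = 0 \<longleftrightarrow> veccong n k 0"
      using veccong_0_Gamma_cc[OF n k(1)] by auto
    ultimately have x: "triangle_mean x = q x"
      unfolding k(2) q_def by (simp only: triangle_mean_CC node_sum_CC[OF n])
    have cont: "continuous_on triangle (\<lambda>t. c * x t)" "continuous_on triangle y"
      using step by (auto intro!: continuous_intros continuous_on_CC simp: k(2))
    have "triangle_mean (\<lambda>t. c * x t + y t) = c * q x + q y"
      using step x by (simp add: triangle_mean_add[OF cont] triangle_mean_cmult)
    also have "\<dots> = q (\<lambda>t. c * x t + y t)"
      by (simp add: q_def distrib_left sum.distrib sum_distrib_left mult_ac)
    finally show ?case
      using cont by (simp add: plus_fun_def continuous_on_add)
  qed
  then show ?thesis
    by (simp add: q_def)
qed

text \<open>Orbit-stabilizer: inside the chamber only \<open>id\<close> fixes \<open>j\<close>, on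
  the wall \<open>j2 = 0\<close> also \<open>sigma3\<close>, on the wall \<open>j1 = j2\<close> also
  \<open>- sigma2\<close>, and at the origin every map.\<close>

lemma card_G2_orbit_sorted:
  assumes "j \<in> Hdag" "0 \<le> j $ 2" "j $ 2 \<le> j $ 1"
  shows "card (G2_orbit j) = (if j $ 1 = 0 then 1 else if j $ 2 = 0 \<or> j $ 1 = j $ 2 then 6 else 12)"
proof -
  have j3: "j $ 3 = - j $ 1 - j $ 2"
    using assms(1) by (simp add: Hdag_def)
  have mem: "id \<in> G2" "sigma3 \<in> G2" "- sigma2 \<in> G2"
    by (simp_all add: G2_elements)
  have "id (vector [1, 2, 4]) \<noteq> sigma3 (vector [1, 2, 4])" "id (vector [1, 2, 4]) \<noteq> (- sigma2) (vector [1, 2, 4])"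
    by (simp_all add: vec3_eq_iff)
  then have ne: "id \<noteq> sigma3" "id \<noteq> - sigma2"
    by metis+
  have comp: "g j $ 1 = j $ 1" "g j $ 2 = j $ 2" "g j $ 3 = j $ 3" if "g j = j" for g
    by (simp_all add: that)
  consider "j $ 1 = 0" | "j $ 2 = 0" "0 < j $ 1" | "j $ 1 = j $ 2" "0 < j $ 2" | "0 < j $ 2" "j $ 2 < j $ 1"
    using assms(2,3) by linarith
  then show ?thesis
  proof cases
    case 1
    then have "j = 0"
      using assms(2,3) by (simp add: vec3_eq_iff j3)
    moreover have "g 0 = 0" if "g \<in> G2" for g
      using G2_add[OF that, of 0 0] by simp
    ultimately have "G2_orbit j = {0}"
      using mem(1) by (auto simp: G2_orbit_eq_image intro!: image_eqI[of _ _ id])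
    with 1 show ?thesis
      by simp
  next
    case 2
    have "g = id \<or> g = sigma3" if g: "g \<in> G2" "g j = j" for g
      using g(1) comp[of g, OF g(2)] 2 j3 unfolding G2_elements by (elim insertE emptyE) simp_all
    moreover have "sigma3 j = j"
      using 2 j3 by (simp add: vec3_eq_iff)
    ultimately have "{g \<in> G2. g j = j} = {id, sigma3}"
      using mem by auto
    then show ?thesis
      using card_G2_orbit[of j] ne 2 by simp
  next
    case 3
    have "g = id \<or> g = - sigma2" if g: "g \<in> G2" "g j = j" for g
      using g(1) comp[of g, OF g(2)] 3 j3 unfolding G2_elements by (elim insertE emptyE) simp_all
    moreover have "(- sigma2) j = j"
      using 3 j3 by (simp add: vec3_eq_iff)
    ultimately have "{g \<in> G2. g j = j} = {id, - sigma2}"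
      using mem by auto
    then show ?thesis
      using card_G2_orbit[of j] ne 3 by simp
  next
    case 4
    have "g = id" if g: "g \<in> G2" "g j = j" for g
      using g(1) comp[of g, OF g(2)] 4 j3 unfolding G2_elements by (elim insertE emptyE) simp_all
    then have "{g \<in> G2. g j = j} = {id}"
      using mem by auto
    then show ?thesis
      using card_G2_orbit[of j] 4 by simp
  qed
qed

lemma c_weight_Upsilon:
  assumes "n \<ge> 1" "j \<in> Upsilon n"
  shows "c_weight n j = (if - j $ 3 < int n then 1 else if j $ 2 = 0 then 1 / 3 else 1 / 2)"
  using assms unfolding c_weight_def permuted_vec3
  by (auto simp: Upsilon_def Hlat_def Hdag_def forall_3)

text \<open>The value 6 arises as \<open>1 * 6\<close> on the two edges through the origin and as
  \<open>1/2 * 12\<close> on the third. At the ends of the third edge the products are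
  \<open>1/3 * 6\<close> and \<open>1/2 * 6\<close>.\<close>

lemma omega_Upsilon:
  assumes "n \<ge> 1" "j \<in> Upsilon n"
  shows "omega n j =
        (if 0 < j $ 2 \<and> j $ 2 < j $ 1 \<and> j $ 1 < - j $ 3 \<and> - j $ 3 < int n then 12
         else if j = vector [0, 0, 0] then 1
         else if j = vector [int n, 0, - int n] then 2
         else if rvec j = vector [real n / 2, real n / 2, - real n] then 3
         else 6)"
proof -
  have j: "j \<in> Hdag" "0 \<le> j $ 2" "j $ 2 \<le> j $ 1" "j $ 3 = - j $ 1 - j $ 2" "- j $ 3 \<le> int n"
    using assms(2) by (auto simp: Upsilon_def Hlat_def Hdag_def)
  \<comment> \<open>The comparison takes place over the reals, so no point matches for odd
    \<open>n\<close>; doubling makes it integer arithmetic.\<close>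
  have half: "rvec j = vector [real n / 2, real n / 2, - real n] \<longleftrightarrow>
      2 * j $ 1 = int n \<and> 2 * j $ 2 = int n \<and> - j $ 3 = int n"
  proof -
    have "rvec j = vector [real n / 2, real n / 2, - real n] \<longleftrightarrow>
      real_of_int (2 * j $ 1) = real_of_int (int n) \<and> real_of_int (2 * j $ 2) = real_of_int (int n)
      \<and> real_of_int (- j $ 3) = real_of_int (int n)"
      by (simp add: vec3_eq_iff rvec_def) linarith
    then show ?thesis
      unfolding of_int_eq_iff .
  qed
  show ?thesis
    unfolding omega_def c_weight_Upsilon[OF assms] card_G2_orbit_sorted[OF j(1-3)] half
    unfolding vec3_eq_iff
    using j(2-5) assms(1) by auto
qed

theorem theorem3p4:
  fixes n :: nat
  assumes "n \<ge> 1"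
  shows
    "(\<forall>f \<in> H_cc (2 * n - 1).
        triangle_mean f = 1 / of_nat n ^ 2 * (\<Sum>j\<in>Upsilon n. of_real (omega n j) * f (node n j)))
   \<and> (\<forall>j \<in> Upsilon n. omega n j =
        (if 0 < j $ 2 \<and> j $ 2 < j $ 1 \<and> j $ 1 < - j $ 3 \<and> - j $ 3 < int n then 12
         else if j = vector [0, 0, 0] then 1
         else if j = vector [int n, 0, - int n] then 2
         else if rvec j = vector [real n / 2, real n / 2, - real n] then 3
         else 6))
   \<and> (\<forall>j \<in> Gamma_cc n. \<forall>k \<in> Gamma_cc n.
        triangle_inner n (CC j) (CC k)
          = of_bool (j = k) / of_real (c_weight n (hat k) * real (card (G2_orbit k)))
      \<and> triangle_inner n (CC j) (CC k) = of_bool (j = k) / of_real (omega n (hat k)))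
   \<and> (\<forall>j \<in> Gamma_sc n. \<forall>k \<in> Gamma_sc n.
        triangle_inner n (SC j) (SC k)
          = of_bool (j = k) / of_real (c_weight n (hat k) * real (card (G2_orbit k)))
      \<and> triangle_inner n (SC j) (SC k) = of_bool (j = k) / of_real (omega n (hat k)))
   \<and> (\<forall>j \<in> Gamma_cs n. \<forall>k \<in> Gamma_cs n.
        triangle_inner n (CS j) (CS k)
          = of_bool (j = k) / of_real (c_weight n (hat k) * real (card (G2_orbit k)))
      \<and> triangle_inner n (CS j) (CS k) = of_bool (j = k) / of_real (omega n (hat k)))
   \<and> (\<forall>j \<in> Gamma_ss n. \<forall>k \<in> Gamma_ss n.
        triangle_inner n (SS j) (SS k)
          = of_bool (j = k) / of_real (c_weight n (hat k) * real (card (G2_orbit k)))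
      \<and> triangle_inner n (SS j) (SS k) = of_bool (j = k) / 12)"
proof -
  have sub: "Gamma_sc n \<subseteq> Gamma_cc n" "Gamma_cs n \<subseteq> Gamma_cc n" "Gamma_ss n \<subseteq> Gamma_cc n"
    by (auto simp: Gamma_cc_def Gamma_sc_def Gamma_cs_def Gamma_ss_def)
  \<comment> \<open>\<open>omega\<close> is taken at \<open>hat k\<close>, whose orbit is as large
    as that of \<open>k\<close>.\<close>
  have weight: "c_weight n (hat k) * real (card (G2_orbit k)) = omega n (hat k)" if "k \<in> Gamma_cc n" for k
    using that by (simp add: c_weight_hat_rot(1)[OF assms] omega_hat_rot(1)[OF assms])
  have cc: "triangle_inner n (CC j) (CC k) = of_bool (j = k) / of_real (omega n (hat k))"
    if "j \<in> Gamma_cc n" "k \<in> Gamma_cc n" for j k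
    unfolding CC_eq_trig[abs_def] by (rule triangle_inner_trig[OF assms G2_char_1 that]) simp_all
  have sc: "triangle_inner n (SC j) (SC k) = of_bool (j = k) / of_real (omega n (hat k))"
    if jk: "j \<in> Gamma_sc n" "k \<in> Gamma_sc n" for j k
    unfolding SC_eq_trig[abs_def] using jk sub(1)
    by (intro triangle_inner_trig[OF assms G2_char_sc] Gamma_stabilizer_char(1)[of _ n k]) auto
  have cs: "triangle_inner n (CS j) (CS k) = of_bool (j = k) / of_real (omega n (hat k))"
    if jk: "j \<in> Gamma_cs n" "k \<in> Gamma_cs n" for j k
    unfolding CS_eq_trig[abs_def] using jk sub(2)
    by (intro triangle_inner_trig[OF assms G2_char_cs] Gamma_stabilizer_char(2)[of _ n k]) auto
  have ss: "triangle_inner n (SS j) (SS k) = of_bool (j = k) / of_real (omega n (hat k))"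
    if jk: "j \<in> Gamma_ss n" "k \<in> Gamma_ss n" for j k
    unfolding SS_eq_trig[abs_def] using jk sub(3)
    by (intro triangle_inner_trig[OF assms G2_char_ss] Gamma_stabilizer_char(3)[of _ n k]) auto
  show ?thesis
    using sub weight cc sc cs ss omega_hat_Gamma_ss[OF assms] quadrature[OF assms] omega_Upsilon[OF assms]
    by (intro conjI ballI) (simp_all add: subset_iff)
qed

end
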